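(* In each of the two cases (L) and (H): let $s>0$ and $m\in\mathbb{N}$. Then there exist constants $C_m>0$ (depending only on $m$) and $L_{s,m}>0$ (depending only on $s,m$) such that for every $n\in\mathbb{N}$ with $n\ge n_s:=8^{2s+1}$, every $L\ge L_{s,m}$ and every estimator $\widehat f$ of $f$ based on an i.i.d. sample $X_1,\dots,X_n$ with density $f$, $$\sup_{f\in\mathcal{D}^{s}_{m}(A,L)}\mathbb{E}^n_f\big(\|\widehat f-f\|_A^2\big)\ \ge\ C_m\, n^{-2s/(2s+1)}.$$
   Context: Two cases are considered. Case (L): $A=(0,\infty)$ and $\varphi_j=\ell_j$ are the Laguerre functions $\ell_j(x)=\sqrt2\,L_j(2x)e^{-x}\mathbf 1_{(0,\infty)}(x)$, $L_j(x)=\sum_{k=0}^j(-1)^k\binom jk\frac{x^k}{k!}$. Case (H): $A=\mathbb{R}$ and $\varphi_j=h_j$ are the Hermite functions $h_j(x)=(2^jj!\sqrt\pi)^{-1/2}H_j(x)e^{-x^2/2}$, $H_j(x)=(-1)^je^{x^2}\frac{d^j}{dx^j}e^{-x^2}$. In each case $(\varphi_j)_{j\ge0}$ is an orthonormal basis of $L^2(A)$, with usual inner product $\langle\cdot,\cdot\rangle_A$ and norm $\|\cdot\|_A$; for $f\in L^2(A)$ put $a_j(f)=\langle f,\varphi_j\rangle_A$, $j\in\mathbb{N}_0$. Put $\alpha=-1/2$ in case (L) and $\alpha=2/3$ in case (H). For $s,L,m>0$, $|f|_s^2:=\sum_{k\in\mathbb{N}_0}k^s|a_k(f)|^2$ and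 $$\mathcal{D}^{s}_{m}(A,L):=\{f\in L^2(A): f\text{ is a probability density on }A,\ |f|_s^2\le L,\ \mathbb{E}_f(|X|^{\alpha m})\le L\},$$ where under $\mathbb{E}_f$ the variable $X$ has density $f$. $\mathbb{E}^n_f$ denotes expectation when $X_1,\dots,X_n$ are i.i.d. with density $f$. An estimator is any measurable $L^2(A)$-valued function of $(X_1,\dots,X_n)$. *)

theory Defs
  imports "HOL-Probability.Probability"
begin

text \<open>The space \<open>L\<^sup>2(A)\<close> is represented by real-valued Borel functions rather than by their
  classes modulo null sets; the values outside \<open>A\<close> are irrelevant.\<close>

abbreviation lborel_on :: "real set \<Rightarrow> real measure" where
  "lborel_on A \<equiv> restrict_space lborel A"

definition L2 :: "real set \<Rightarrow> (real \<Rightarrow> real) set" where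
  "L2 A = {f \<in> borel_measurable (lborel_on A). integrable (lborel_on A) (\<lambda>x. (f x)\<^sup>2)}"

definition L2_inner :: "real set \<Rightarrow> (real \<Rightarrow> real) \<Rightarrow> (real \<Rightarrow> real) \<Rightarrow> real" where
  "L2_inner A f g = (LINT x|lborel_on A. f x * g x)"

definition L2_norm :: "real set \<Rightarrow> (real \<Rightarrow> real) \<Rightarrow> real" where
  "L2_norm A f = sqrt (L2_inner A f f)"

text \<open>The Borel \<open>\<sigma>\<close>-algebra of the seminorm \<open>L2_norm A\<close>. Its sets are closed under a.e. equality,
  so they are exactly the preimages of the Borel sets of the quotient \<open>L\<^sup>2(A)\<close>.\<close>

definition L2_open :: "real set \<Rightarrow> (real \<Rightarrow> real) set \<Rightarrow> bool" where
  "L2_open A U \<longleftrightarrow> U \<subseteq> L2 A \<and>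
     (\<forall>f\<in>U. \<exists>e>0. \<forall>g\<in>L2 A. L2_norm A (\<lambda>x. g x - f x) < e \<longrightarrow> g \<in> U)"

definition L2_borel :: "real set \<Rightarrow> (real \<Rightarrow> real) measure" where
  "L2_borel A = sigma (L2 A) {U. L2_open A U}"

definition laguerre_poly :: "nat \<Rightarrow> real \<Rightarrow> real" where
  "laguerre_poly j x = (\<Sum>k\<le>j. (-1) ^ k * real (j choose k) * (x ^ k / fact k))"

definition laguerre_fun :: "nat \<Rightarrow> real \<Rightarrow> real" where
  "laguerre_fun j x = sqrt 2 * laguerre_poly j (2 * x) * exp (- x) * indicator {0<..} x"

definition hermite_poly :: "nat \<Rightarrow> real \<Rightarrow> real" where
  "hermite_poly j x = (-1) ^ j * exp (x\<^sup>2) * (deriv ^^ j) (\<lambda>y. exp (- y\<^sup>2)) x"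

definition hermite_fun :: "nat \<Rightarrow> real \<Rightarrow> real" where
  "hermite_fun j x =
     (2 ^ j * fact j * sqrt pi) powr (-1/2) * hermite_poly j x * exp (- x\<^sup>2 / 2)"

datatype basis_case = Laguerre | Hermite

fun dom_of :: "basis_case \<Rightarrow> real set" where
  "dom_of Laguerre = {0<..}"
| "dom_of Hermite = UNIV"

fun basis_of :: "basis_case \<Rightarrow> nat \<Rightarrow> real \<Rightarrow> real" where
  "basis_of Laguerre = laguerre_fun"
| "basis_of Hermite = hermite_fun"

fun alpha_of :: "basis_case \<Rightarrow> real" where
  "alpha_of Laguerre = -1/2"
| "alpha_of Hermite = 2/3"

definition basis_coeff :: "basis_case \<Rightarrow> nat \<Rightarrow> (real \<Rightarrow> real) \<Rightarrow> real" where
  "basis_coeff c j f = L2_inner (dom_of c) f (basis_of c j)"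

text \<open>Possibly infinite, hence valued in \<^typ>\<open>ennreal\<close>. The term \<open>k = 0\<close> vanishes, since
  \<open>0 powr s = 0\<close>.\<close>

definition sobolev_sq :: "basis_case \<Rightarrow> real \<Rightarrow> (real \<Rightarrow> real) \<Rightarrow> ennreal" where
  "sobolev_sq c s f = (\<Sum>k. ennreal (real k powr s * \<bar>basis_coeff c k f\<bar>\<^sup>2))"

definition prob_density_on :: "real set \<Rightarrow> (real \<Rightarrow> real) \<Rightarrow> bool" where
  "prob_density_on A f \<longleftrightarrow> f \<in> borel_measurable (lborel_on A) \<and>
     (AE x in lborel_on A. 0 \<le> f x) \<and> (\<integral>\<^sup>+x. ennreal (f x) \<partial>lborel_on A) = 1"

definition law_of :: "basis_case \<Rightarrow> (real \<Rightarrow> real) \<Rightarrow> real measure" where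
  "law_of c f = density (lborel_on (dom_of c)) (\<lambda>x. ennreal (f x))"

definition density_class :: "basis_case \<Rightarrow> real \<Rightarrow> real \<Rightarrow> real \<Rightarrow> (real \<Rightarrow> real) set" where
  "density_class c s m L = {f \<in> L2 (dom_of c). prob_density_on (dom_of c) f \<and>
     sobolev_sq c s f \<le> ennreal L \<and>
     (\<integral>\<^sup>+x. ennreal (\<bar>x\<bar> powr (alpha_of c * m)) \<partial>law_of c f) \<le> ennreal L}"

definition estimator :: "basis_case \<Rightarrow> nat \<Rightarrow> ((nat \<Rightarrow> real) \<Rightarrow> real \<Rightarrow> real) \<Rightarrow> bool" where
  "estimator c n fhat \<longleftrightarrow>
     fhat \<in> (\<Pi>\<^sub>M i\<in>{..<n}. restrict_space borel (dom_of c)) \<rightarrow>\<^sub>M L2_borel (dom_of c)"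

definition risk ::
  "basis_case \<Rightarrow> nat \<Rightarrow> ((nat \<Rightarrow> real) \<Rightarrow> real \<Rightarrow> real) \<Rightarrow> (real \<Rightarrow> real) \<Rightarrow> ennreal" where
  "risk c n fhat f =
     (\<integral>\<^sup>+X. ennreal ((L2_norm (dom_of c) (\<lambda>x. fhat X x - f x))\<^sup>2) \<partial>(\<Pi>\<^sub>M i\<in>{..<n}. law_of c f))"

end

theory Submission
  imports Defs
begin

text \<open>
  A smooth density supported in \<open>[1, 2]\<close> is perturbed by \<open>K \<approx> n\<^bsup>1/(2s+1)\<^esup>\<close> disjoint rescaled copies of the
  derivative of a bump, each switched on or off, with amplitude \<open>\<epsilon>\<close> where \<open>\<epsilon>\<^sup>2\<close> is of order \<open>K / n\<close>. A single
  switch changes the density by a chi-square distance of order \<open>1 / n\<close>, so the switches cannot be identified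
  from \<open>n\<close> observations, and Assouad's argument bounds the risk below by a multiple of
  \<open>\<epsilon>\<^sup>2 \<ge> c n\<^bsup>-2s/(2s+1)\<^esup>\<close>. Compact support inside \<open>(0, \<infinity>)\<close> makes the moment condition trivial. For the
  Sobolev condition, both bases diagonalize a second-order operator \<open>T f = - (P f')' + Q f\<close> with eigenvalues
  \<open>2 j + 1\<close>. As \<open>T\<^sup>p\<close> costs a factor \<open>K\<^bsup>2p\<^esup>\<close> on the perturbations, Bessel's inequality applied to them
  and to their images under \<open>T\<^sup>p\<close>, together with \<open>j\<^sup>s \<le> K\<^bsup>2s\<^esup> (1 + ((2 j + 1) / K\<^sup>2)\<^bsup>2p\<^esup>)\<close> for \<open>s \<le> 2 p\<close>, bounds
  their Sobolev sums by a multiple of \<open>\<epsilon>\<^sup>2 K\<^bsup>2s\<^esup> = O(1)\<close>.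
\<close>

section \<open>A smooth bump function\<close>

text \<open>The constant \<open>C\<close> has to be chosen before \<open>s\<close>. Hence the scale
  \<open>\<eta>\<close> of the amplitude \<open>\<epsilon>^2 = \<eta> K / n\<close> is fixed from
  the bump alone, and \<open>s\<close> enters only through the number \<open>K\<close> of copies and
  the threshold for \<open>L\<close>. Two facts keep \<open>\<eta>\<close> independent of
  \<open>K\<close>: disjoint supports stop the sup norm of a sum of copies from growing with their
  number, and the base density, which vanishes at 1 and 2, is perturbed only on
  \<open>[5/4, 7/4]\<close>, where it has a positive lower bound. The Sobolev estimate must be
  uniform in frequency and shifts, so \<open>T\<close> acts on whole families in which
  \<open>K\<close> and \<open>t\<close> remain variables and one constant bounds all members. An
  arbitrary estimator is not rounded to a choice of switches: each switch is judged by a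
  likelihood-weighted squared error minimized over all real guesses, and only the integral of that
  minimum has to be bounded below.\<close>

definition flat :: "real poly \<Rightarrow> real \<Rightarrow> real" where
  "flat p x = (if 0 < x then poly p (1 / x) * exp (- (1 / x)) else 0)"

lemma flat_tendsto_0: "(flat p \<longlongrightarrow> 0) (at_right 0)"
proof -
  have "((\<lambda>y. poly p y * exp (- y)) \<longlongrightarrow> 0) at_top"
  proof -
    have "((\<lambda>y. \<Sum>i\<le>degree p. coeff p i * (y ^ i / exp y)) \<longlongrightarrow> (\<Sum>i\<le>degree p. coeff p i * 0)) at_top"
      by (intro tendsto_intros tendsto_power_div_exp_0)
    thus ?thesis
      by (simp add: poly_altdef sum_divide_distrib exp_minus field_simps)
  qed
  from filterlim_compose[OF this filterlim_inverse_at_top_right]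
  have "((\<lambda>x. poly p (inverse x) * exp (- inverse x)) \<longlongrightarrow> 0) (at_right 0)" .
  thus ?thesis
    by (rule Lim_transform_eventually)
       (auto simp: eventually_at_right_field flat_def field_simps intro!: exI[of _ 1])
qed

text \<open>With \<open>y = 1 / x\<close> one has \<open>d/dx = - y^2 d/dy\<close>, which sends
  \<open>p(y) exp (- y)\<close> to \<open>y^2 (p - p')(y) exp (- y)\<close>. Allowing all
  polynomials \<open>p\<close> thus gives a class closed under differentiation.\<close>

lemma flat_pos_deriv:
  assumes "0 < x"
  shows "(flat p has_real_derivative flat ([:0, 0, 1:] * (p - pderiv p)) x) (at x)"
proof -
  have "((\<lambda>x. poly p (1 / x) * exp (- (1 / x))) has_real_derivative
      flat ([:0, 0, 1:] * (p - pderiv p)) x) (at x)"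
    using assms by (auto intro!: derivative_eq_intros poly_DERIV[THEN DERIV_chain2]
      simp: flat_def field_simps power2_eq_square)
  thus ?thesis
    by (rule has_field_derivative_transform_within_open[of _ _ _ "{0<..}"])
       (use assms in \<open>auto simp: flat_def\<close>)
qed

lemma flat_deriv: "(flat p has_real_derivative flat ([:0, 0, 1:] * (p - pderiv p)) x) (at x)"
proof -
  consider "0 < x" | "x < 0" | "x = 0" by linarith
  thus ?thesis
  proof cases
    case 1 thus ?thesis by (rule flat_pos_deriv)
  next
    case 2
    have "(flat p has_real_derivative 0) (at x)"
      by (rule has_field_derivative_transform_within_open[of "\<lambda>_. 0" _ _ "{..<0}"])
         (use 2 in \<open>auto simp: flat_def\<close>)
    thus ?thesis using 2 by (simp add: flat_def)
  next
    case 3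
    have "((\<lambda>h. flat p h / h) \<longlongrightarrow> 0) (at 0)"
      unfolding filterlim_at_split
    proof
      have "((\<lambda>h. 0::real) \<longlongrightarrow> 0) (at_left 0)" by simp
      thus "((\<lambda>h. flat p h / h) \<longlongrightarrow> 0) (at_left 0)"
        by (rule Lim_transform_eventually)
           (auto simp: eventually_at_left_field flat_def intro!: exI[of _ "-1"])
      \<comment> \<open>For \<open>h > 0\<close> the difference quotient is again a flat function,
        with \<open>p\<close> multiplied by the variable, so its limit is already known.\<close>
      show "((\<lambda>h. flat p h / h) \<longlongrightarrow> 0) (at_right 0)"
        by (rule Lim_transform_eventually[OF flat_tendsto_0[of "[:0, 1:] * p"]])
           (auto simp: eventually_at_right_field flat_def intro!: exI[of _ 1])
    qed
    thus ?thesis using 3 by (simp add: has_field_derivative_iff flat_def)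
  qed
qed

definition smooth :: "(real \<Rightarrow> real) \<Rightarrow> bool" where
  "smooth f \<longleftrightarrow> (\<forall>i x. (deriv ^^ i) f field_differentiable at x)"

lemma smoothI_closed:
  assumes "f \<in> F" and "\<And>f. f \<in> F \<Longrightarrow> \<exists>g\<in>F. \<forall>x. (f has_real_derivative g x) (at x)"
  shows "smooth f"
proof -
  have "(deriv ^^ i) f \<in> F" for i
  proof (induction i)
    case (Suc i)
    then obtain g where g: "g \<in> F" "\<And>x. ((deriv ^^ i) f has_real_derivative g x) (at x)"
      using assms(2) by blast
    hence "(deriv ^^ Suc i) f = g" using DERIV_imp_deriv by fastforce
    thus ?case using g by simp
  qed (use assms in auto)
  thus ?thesis
    using assms(2) unfolding smooth_def field_differentiable_def by blast
qed

text \<open>One factor switches on at 1, the other switches off at 2. Sums are included because the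
  product rule yields two products; this makes the class closed under differentiation.\<close>

inductive_set flat_prods :: "(real \<Rightarrow> real) set" where
  prod: "(\<lambda>x. flat p (x - 1) * flat q (2 - x)) \<in> flat_prods"
| add: "f \<in> flat_prods \<Longrightarrow> g \<in> flat_prods \<Longrightarrow> (\<lambda>x. f x + g x) \<in> flat_prods"

lemma flat_prods_deriv:
  "f \<in> flat_prods \<Longrightarrow> \<exists>g\<in>flat_prods. \<forall>x. (f has_real_derivative g x) (at x)"
proof (induction rule: flat_prods.induct)
  case (prod p q)
  define dd where "dd = (\<lambda>p::real poly. [:0, 0, 1:] * (p - pderiv p))"
  have neg: "flat (- r) x = - flat r x" for r x by (simp add: flat_def)
  have "((\<lambda>x. flat p (x - 1) * flat q (2 - x)) has_real_derivative
     (flat (dd p) (x - 1) * flat q (2 - x) + flat p (x - 1) * flat (- dd q) (2 - x))) (at x)" for x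
    unfolding dd_def neg
    by (auto intro!: derivative_eq_intros flat_deriv[THEN DERIV_chain2])
  thus ?case
    by (intro bexI[of _ "\<lambda>x. flat (dd p) (x - 1) * flat q (2 - x) + flat p (x - 1) * flat (- dd q) (2 - x)"]
         flat_prods.intros) auto
next
  case (add f g)
  then obtain f' g' where "f' \<in> flat_prods" "g' \<in> flat_prods" 
    "\<And>x. (f has_real_derivative f' x) (at x)" "\<And>x. (g has_real_derivative g' x) (at x)" by blast
  thus ?case by (intro bexI[of _ "\<lambda>x. f' x + g' x"] flat_prods.intros) (auto intro!: derivative_intros)
qed

definition bump :: "real \<Rightarrow> real" where
  "bump x = flat 1 (x - 1) * flat 1 (2 - x)"

abbreviation bump_deriv :: "nat \<Rightarrow> real \<Rightarrow> real" where
  "bump_deriv i \<equiv> (deriv ^^ i) bump"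

lemma bump_deriv_deriv: "(bump_deriv i has_real_derivative bump_deriv (Suc i) x) (at x)"
proof -
  have "bump \<in> flat_prods"
    using flat_prods.prod[of 1 1] by (simp add: bump_def[abs_def])
  hence "smooth bump"
    by (rule smoothI_closed) (rule flat_prods_deriv)
  thus ?thesis unfolding smooth_def by (simp add: field_differentiable_derivI)
qed

lemma isCont_bump_deriv: "isCont (bump_deriv i) x"
  using bump_deriv_deriv by (rule DERIV_isCont)

lemma bump_deriv_eq_0: "x \<notin> {1<..<2} \<Longrightarrow> bump_deriv i x = 0"
proof -
  have out: "bump_deriv i x = 0" if "x \<in> {..<1} \<union> {2<..}" for x
    using that
  proof (induction i arbitrary: x)
    case 0 thus ?case by (auto simp: bump_def flat_def)
  next
    case (Suc i)
    have "(bump_deriv i has_real_derivative 0) (at x)"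
      by (rule has_field_derivative_transform_within_open[of "\<lambda>_. 0" _ _ "{..<1} \<union> {2<..}"])
         (use Suc in auto)
    thus ?case using bump_deriv_deriv[of i x] DERIV_unique by blast
  qed
  \<comment> \<open>The induction works on an open set and so omits the endpoints 1 and 2;
    continuity of the derivative adds them.\<close>
  have cl: "closed {y. bump_deriv i y = 0}"
    by (intro closed_Collect_eq continuous_at_imp_continuous_on ballI isCont_bump_deriv continuous_on_const)
  have "closure ({..<1} \<union> {2<..}) \<subseteq> {y. bump_deriv i y = 0}"
    by (rule closure_minimal) (use out cl in auto)
  moreover assume "x \<notin> {1<..<2}"
  ultimately show ?thesis by (auto simp: closure_Un subset_iff not_less)
qed

lemma bump_nonneg: "0 \<le> bump x"
  by (auto simp: bump_def flat_def)

lemma bump_pos: "x \<in> {1<..<2} \<Longrightarrow> 0 < bump x"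
  by (auto simp: bump_def flat_def)

lemma continuous_on_bump_deriv: "continuous_on S (bump_deriv i)"
  by (intro continuous_at_imp_continuous_on ballI isCont_bump_deriv)

lemma bump_deriv_bounded: "\<exists>C\<ge>0. \<forall>x. \<bar>bump_deriv i x\<bar> \<le> C"
proof -
  have "bounded (bump_deriv i ` {1..2})"
    by (intro compact_imp_bounded compact_continuous_image continuous_on_bump_deriv) auto
  then obtain C where C: "\<And>x. x \<in> {1..2} \<Longrightarrow> \<bar>bump_deriv i x\<bar> \<le> C"
    by (fastforce simp: bounded_iff)
  have "\<bar>bump_deriv i x\<bar> \<le> max C 0" for x
    using C[of x] bump_deriv_eq_0[of x i] by (cases "x \<in> {1..2}") (auto simp: le_max_iff_disj)
  thus ?thesis by (intro exI[of _ "max C 0"]) auto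
qed

section \<open>Oscillating families\<close>

text \<open>Families \<open>u K t x\<close> built from derivatives of the bump rescaled to frequency \<open>K\<close> and shifted
  by \<open>t\<close>; the index bounds the power of \<open>K\<close> that controls the family.\<close>

inductive osc :: "nat \<Rightarrow> (real \<Rightarrow> real \<Rightarrow> real \<Rightarrow> real) \<Rightarrow> bool" where
  base: "j \<le> r \<Longrightarrow> osc r (\<lambda>K t x. a * K ^ j * x ^ l * bump_deriv i (K * x - t))"
| add: "osc r u \<Longrightarrow> osc r v \<Longrightarrow> osc r (\<lambda>K t x. u K t x + v K t x)"

lemma osc_mono: "osc r u \<Longrightarrow> r \<le> r' \<Longrightarrow> osc r' u"
  by (induction rule: osc.induct) (auto intro: osc.intros)

lemma osc_bump_deriv: "osc r (\<lambda>K t x. bump_deriv i (K * x - t))"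
  using osc.base[of 0 r 1 0 i] by simp

lemma osc_scale: "osc r u \<Longrightarrow> osc r (\<lambda>K t x. c * u K t x)"
proof (induction rule: osc.induct)
  case (base j r a l i)
  thus ?case using osc.base[of j r "c * a" l i] by (simp add: mult.assoc)
qed (auto simp: distrib_left intro: osc.intros)

lemma osc_mult_ident: "osc r u \<Longrightarrow> osc r (\<lambda>K t x. x * u K t x)"
proof (induction rule: osc.induct)
  case (base j r a l i)
  thus ?case using osc.base[of j r a "Suc l" i] by (simp add: mult_ac)
qed (auto simp: distrib_left intro: osc.intros)

lemma osc_deriv:
  "osc r u \<Longrightarrow> \<exists>v. osc (Suc r) v \<and> (\<forall>K t x. (u K t has_real_derivative v K t x) (at x))"
proof (induction rule: osc.induct)
  case (base j r a l i)
  \<comment> \<open>For \<open>l = 0\<close> the truncated exponent \<open>l - 1\<close> is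
    harmless, because the factor \<open>real l\<close> vanishes. Only the term in which the bump is
    differentiated gains a factor \<open>K\<close>.\<close>
  let ?v = "\<lambda>K t x. (a * real l) * K ^ j * x ^ (l - 1) * bump_deriv i (K * x - t)
    + a * K ^ Suc j * x ^ l * bump_deriv (Suc i) (K * x - t)"
  have "osc (Suc r) ?v"
    using base by (intro osc.intros) auto
  moreover have "((\<lambda>x. a * K ^ j * x ^ l * bump_deriv i (K * x - t)) has_real_derivative ?v K t x) (at x)"
    for K t x
    by (rule derivative_eq_intros refl bump_deriv_deriv[THEN DERIV_chain2] | simp add: algebra_simps)+
  ultimately show ?case by (intro exI[of _ ?v]) blast
next
  case (add r u v)
  then obtain u' v' where "osc (Suc r) u'" "osc (Suc r) v'"
    "\<And>K t x. (u K t has_real_derivative u' K t x) (at x)"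
    "\<And>K t x. (v K t has_real_derivative v' K t x) (at x)" by blast
  thus ?case
    by (intro exI[of _ "\<lambda>K t x. u' K t x + v' K t x"])
       (auto intro!: osc.intros derivative_intros)
qed

lemma osc_eq_0: "osc r u \<Longrightarrow> K * x - t \<notin> {1<..<2} \<Longrightarrow> u K t x = 0"
  by (induction rule: osc.induct) (auto simp: bump_deriv_eq_0)

lemma isCont_osc: "osc r u \<Longrightarrow> isCont (u K t) x"
  using osc_deriv[of r u] by (auto intro: DERIV_isCont)

text \<open>\<open>C\<close> is chosen before \<open>K\<close> and \<open>t\<close>. The range
  \<open>[1, 2]\<close> bounds the powers of \<open>x\<close>, and \<open>K \<ge> 1\<close> lets
  every \<open>K ^ j\<close> with \<open>j \<le> r\<close> be absorbed into
  \<open>K ^ r\<close>.\<close>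

lemma osc_bounded:
  "osc r u \<Longrightarrow> \<exists>C\<ge>0. \<forall>K\<ge>1. \<forall>t. \<forall>x\<in>{1..2}. \<bar>u K t x\<bar> \<le> C * K ^ r"
proof (induction rule: osc.induct)
  case (base j r a l i)
  obtain B where B: "B \<ge> 0" "\<And>x. \<bar>bump_deriv i x\<bar> \<le> B"
    using bump_deriv_bounded by blast
  have "\<bar>a * K ^ j * x ^ l * bump_deriv i (K * x - t)\<bar> \<le> (\<bar>a\<bar> * 2 ^ l * B) * K ^ r"
    if "K \<ge> 1" "x \<in> {1..2}" for K t x
  proof -
    have "\<bar>a * K ^ j * x ^ l * bump_deriv i (K * x - t)\<bar> =
      \<bar>a\<bar> * K ^ j * x ^ l * \<bar>bump_deriv i (K * x - t)\<bar>"
      using that by (simp add: abs_mult)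
    also have "\<dots> \<le> \<bar>a\<bar> * K ^ r * 2 ^ l * B"
      using that B base by (intro mult_mono power_increasing power_mono) auto
    finally show ?thesis by (simp add: mult_ac)
  qed
  thus ?case using B by (intro exI[of _ "\<bar>a\<bar> * 2 ^ l * B"]) auto
next
  case (add r u v)
  then obtain C D where C: "C \<ge> 0" "D \<ge> 0"
    "\<And>K t x. K \<ge> 1 \<Longrightarrow> x \<in> {1..2} \<Longrightarrow> \<bar>u K t x\<bar> \<le> C * K ^ r"
    "\<And>K t x. K \<ge> 1 \<Longrightarrow> x \<in> {1..2} \<Longrightarrow> \<bar>v K t x\<bar> \<le> D * K ^ r" by blast
  have "\<bar>u K t x + v K t x\<bar> \<le> (C + D) * K ^ r" if "K \<ge> 1" "x \<in> {1..2}" for K t x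
    using C(3,4)[OF that, of t] by (simp add: algebra_simps)
  thus ?case using C by (intro exI[of _ "C + D"]) auto
qed

section \<open>The space \<open>L\<^sup>2(A)\<close>\<close>

lemma L2_I: "f \<in> borel_measurable (lborel_on A) \<Longrightarrow> integrable (lborel_on A) (\<lambda>x. (f x)\<^sup>2) \<Longrightarrow> f \<in> L2 A"
  by (simp add: L2_def)

lemma L2_measurable: "f \<in> L2 A \<Longrightarrow> f \<in> borel_measurable (lborel_on A)"
  by (simp add: L2_def)

lemma L2_mult_integrable:
  assumes "f \<in> L2 A" "g \<in> L2 A"
  shows "integrable (lborel_on A) (\<lambda>x. f x * g x)"
proof (rule Bochner_Integration.integrable_bound)
  show "integrable (lborel_on A) (\<lambda>x. (f x)\<^sup>2 + (g x)\<^sup>2)"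
    using assms by (simp add: L2_def)
  show "(\<lambda>x. f x * g x) \<in> borel_measurable (lborel_on A)"
    using assms by (auto simp: L2_def intro: borel_measurable_times)
  have "\<bar>a * b\<bar> \<le> a\<^sup>2 + b\<^sup>2" for a b :: real
  proof -
    have "0 \<le> \<bar>a\<bar> * \<bar>b\<bar>" by simp
    thus ?thesis
      using zero_le_power2[of "\<bar>a\<bar> - \<bar>b\<bar>"] unfolding power2_diff abs_mult power2_abs by linarith
  qed
  thus "AE x in lborel_on A. norm (f x * g x) \<le> norm ((f x)\<^sup>2 + (g x)\<^sup>2)"
    by simp
qed

lemma L2_add: "f \<in> L2 A \<Longrightarrow> g \<in> L2 A \<Longrightarrow> (\<lambda>x. f x + g x) \<in> L2 A"
  using L2_mult_integrable[of f A g]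
  by (auto simp: L2_def power2_sum mult.assoc)

lemma L2_scale: "f \<in> L2 A \<Longrightarrow> (\<lambda>x. c * f x) \<in> L2 A"
  by (auto simp: L2_def power_mult_distrib)

lemma L2_diff: "f \<in> L2 A \<Longrightarrow> g \<in> L2 A \<Longrightarrow> (\<lambda>x. f x - g x) \<in> L2 A"
  using L2_add[of f A "\<lambda>x. -1 * g x"] L2_scale[of g A "-1"] by simp

lemma L2_sum: "(\<And>i. i \<in> I \<Longrightarrow> f i \<in> L2 A) \<Longrightarrow> (\<lambda>x. \<Sum>i\<in>I. f i x) \<in> L2 A"
proof (induction I rule: infinite_finite_induct)
  case (insert i I)
  thus ?case by (auto intro: L2_add)
qed (simp_all add: L2_def)

lemma L2_inner_commute: "L2_inner A f g = L2_inner A g f"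
  by (simp add: L2_inner_def mult.commute)

lemma L2_inner_add_left:
  "f \<in> L2 A \<Longrightarrow> g \<in> L2 A \<Longrightarrow> h \<in> L2 A \<Longrightarrow>
   L2_inner A (\<lambda>x. f x + g x) h = L2_inner A f h + L2_inner A g h"
  by (simp add: L2_inner_def distrib_right L2_mult_integrable)

lemma L2_inner_diff_left:
  "f \<in> L2 A \<Longrightarrow> g \<in> L2 A \<Longrightarrow> h \<in> L2 A \<Longrightarrow>
   L2_inner A (\<lambda>x. f x - g x) h = L2_inner A f h - L2_inner A g h"
  by (simp add: L2_inner_def left_diff_distrib L2_mult_integrable)

lemma L2_inner_scale_left: "L2_inner A (\<lambda>x. c * f x) g = c * L2_inner A f g"
  by (simp add: L2_inner_def mult.assoc)

lemma L2_inner_sum_left: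
  "(\<And>i. i \<in> I \<Longrightarrow> f i \<in> L2 A) \<Longrightarrow> h \<in> L2 A \<Longrightarrow>
   L2_inner A (\<lambda>x. \<Sum>i\<in>I. f i x) h = (\<Sum>i\<in>I. L2_inner A (f i) h)"
  unfolding L2_inner_def sum_distrib_right
  by (subst Bochner_Integration.integral_sum) (auto intro: L2_mult_integrable)

lemma L2_inner_add_right:
  "f \<in> L2 A \<Longrightarrow> g \<in> L2 A \<Longrightarrow> h \<in> L2 A \<Longrightarrow>
   L2_inner A h (\<lambda>x. f x + g x) = L2_inner A h f + L2_inner A h g"
  by (simp add: L2_inner_def distrib_left L2_mult_integrable)

lemma L2_inner_diff_right:
  "f \<in> L2 A \<Longrightarrow> g \<in> L2 A \<Longrightarrow> h \<in> L2 A \<Longrightarrow>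
   L2_inner A h (\<lambda>x. f x - g x) = L2_inner A h f - L2_inner A h g"
  by (simp add: L2_inner_def right_diff_distrib L2_mult_integrable)

lemma L2_inner_self_nonneg: "0 \<le> L2_inner A f f"
  by (simp add: L2_inner_def)

lemma L2_norm_power2: "(L2_norm A f)\<^sup>2 = L2_inner A f f"
  by (simp add: L2_norm_def L2_inner_self_nonneg)

lemma L2_norm_nonneg: "0 \<le> L2_norm A f"
  by (simp add: L2_norm_def L2_inner_self_nonneg)

lemma L2_inner_diff_diff:
  assumes "f \<in> L2 A" "g \<in> L2 A"
  shows "L2_inner A (\<lambda>x. f x - g x) (\<lambda>x. f x - g x) =
    L2_inner A f f - 2 * L2_inner A f g + L2_inner A g g"
  using assms
  by (simp add: L2_inner_diff_left L2_inner_diff_right L2_diff L2_inner_commute[of A g f])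

text \<open>The squared norm of \<open>u\<close> minus its projection \<open>v\<close> is
  nonnegative. A common squared norm \<open>w\<close> is allowed so that the bound serves both the
  orthonormal basis (\<open>w = 1\<close>) and the unnormalized perturbations.\<close>

lemma bessel_inequality:
  assumes "u \<in> L2 A" "\<And>j. j \<in> J \<Longrightarrow> e j \<in> L2 A" "w > 0" and "finite J"
    and ortho: "\<And>i j. i \<in> J \<Longrightarrow> j \<in> J \<Longrightarrow> L2_inner A (e i) (e j) = (if i = j then w else 0)"
  shows "(\<Sum>j\<in>J. (L2_inner A u (e j))\<^sup>2) \<le> w * L2_inner A u u"
proof -
  define a where "a j = L2_inner A u (e j) / w" for j
  define v where "v = (\<lambda>x. \<Sum>j\<in>J. a j * e j x)"
  have v: "v \<in> L2 A" unfolding v_def by (intro L2_sum L2_scale assms)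
  have ve: "L2_inner A v h = (\<Sum>j\<in>J. a j * L2_inner A (e j) h)" if "h \<in> L2 A" for h
    using that assms unfolding v_def
    by (subst L2_inner_sum_left) (auto intro: L2_scale simp: L2_inner_scale_left)
  have uv: "L2_inner A u v = (\<Sum>j\<in>J. (a j)\<^sup>2) * w"
    using assms(1,3) ve[of u] unfolding L2_inner_commute[of A u v]
    by (simp add: L2_inner_commute[of A _ u] a_def sum_distrib_right power2_eq_square)
  have vej: "L2_inner A (e j) v = a j * w" if "j \<in> J" for j
    using that assms ve[of "e j"] unfolding L2_inner_commute[of A "e j" v]
    by (simp add: ortho if_distrib cong: if_cong)
  have vv: "L2_inner A v v = (\<Sum>j\<in>J. (a j)\<^sup>2) * w"
    using ve[OF v] by (simp add: vej sum_distrib_left power2_eq_square mult_ac)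
  have "0 \<le> L2_inner A u u - (\<Sum>j\<in>J. (a j)\<^sup>2) * w"
    using L2_inner_self_nonneg[of A "\<lambda>x. u x - v x"] L2_inner_diff_diff[OF assms(1) v] uv vv
    by (simp add: mult.commute)
  hence "w * ((\<Sum>j\<in>J. (a j)\<^sup>2) * w) \<le> w * L2_inner A u u"
    using assms by (intro mult_left_mono) auto
  moreover have "w * ((\<Sum>j\<in>J. (a j)\<^sup>2) * w) = (\<Sum>j\<in>J. (L2_inner A u (e j))\<^sup>2)"
    using \<open>w > 0\<close> by (simp add: a_def sum_distrib_left sum_distrib_right power2_eq_square)
  ultimately show ?thesis by simp
qed

lemma L2_Cauchy_Schwarz:
  assumes "f \<in> L2 A" "g \<in> L2 A"
  shows "L2_inner A f g \<le> L2_norm A f * L2_norm A g"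
proof -
  define p q where "p = L2_norm A f" and "q = L2_norm A g"
  have pq: "p \<ge> 0" "q \<ge> 0" by (simp_all add: p_def q_def L2_norm_nonneg)
  have ineq: "2 * t * L2_inner A f g \<le> p\<^sup>2 + t\<^sup>2 * q\<^sup>2" for t
    using L2_inner_self_nonneg[of A "\<lambda>x. f x - t * g x"]
      L2_inner_diff_diff[OF assms(1) L2_scale[OF assms(2), of t]]
      L2_inner_commute[of A f "\<lambda>x. t * g x"] L2_inner_commute[of A g "\<lambda>x. t * g x"]
      L2_inner_commute[of A f g]
    unfolding p_def q_def L2_norm_power2
    by (simp add: L2_inner_scale_left power2_eq_square mult_ac)
  show ?thesis
  proof (cases "q = 0")
    case True
    have "L2_inner A f g \<le> 0"
    proof (rule ccontr)
      assume "\<not> ?thesis"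
      \<comment> \<open>With \<open>q = 0\<close> the right side of \<open>ineq\<close> is the
        constant \<open>p^2\<close>, while this \<open>t\<close> makes the left side
        \<open>p^2 + 1\<close>.\<close>
      thus False using ineq[of "(p\<^sup>2 + 1) / (2 * L2_inner A f g)"] True by simp
    qed
    thus ?thesis using True by (simp add: q_def)
  next
    case False
    have "2 * ((L2_inner A f g)\<^sup>2 / q\<^sup>2) \<le> p\<^sup>2 + (L2_inner A f g)\<^sup>2 / q\<^sup>2"
      using ineq[of "L2_inner A f g / q\<^sup>2"] False by (simp add: power2_eq_square)
    hence "(L2_inner A f g)\<^sup>2 / q\<^sup>2 \<le> p\<^sup>2" by linarith
    hence "(L2_inner A f g)\<^sup>2 \<le> (p * q)\<^sup>2"
      using False by (simp add: pos_divide_le_eq power_mult_distrib)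
    thus ?thesis using pq by (auto simp: p_def q_def intro: power2_le_imp_le)
  qed
qed

lemma L2_norm_triangle:
  assumes "f \<in> L2 A" "g \<in> L2 A"
  shows "L2_norm A (\<lambda>x. f x + g x) \<le> L2_norm A f + L2_norm A g"
proof (rule power2_le_imp_le)
  have "(L2_norm A (\<lambda>x. f x + g x))\<^sup>2 = L2_inner A f f + 2 * L2_inner A f g + L2_inner A g g"
    using assms by (simp add: L2_norm_power2 L2_inner_add_left L2_inner_add_right L2_add
      L2_inner_commute[of A g f])
  also have "\<dots> \<le> (L2_norm A f + L2_norm A g)\<^sup>2"
    using L2_Cauchy_Schwarz[OF assms] by (simp add: power2_sum L2_norm_power2)
  finally show "(L2_norm A (\<lambda>x. f x + g x))\<^sup>2 \<le> (L2_norm A f + L2_norm A g)\<^sup>2" .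
qed (simp add: L2_norm_nonneg)

lemma space_L2_borel: "space (L2_borel A) = L2 A"
  unfolding L2_borel_def by (rule space_measure_of) (auto simp: L2_open_def)

text \<open>Makes the loss of an estimator measurable. By the triangle inequality the sublevel sets
  are open for the seminorm, hence generators of \<open>L2_borel\<close>.\<close>

lemma borel_measurable_L2_dist:
  assumes f: "f \<in> L2 A"
  shows "(\<lambda>g. L2_norm A (\<lambda>x. g x - f x)) \<in> borel_measurable (L2_borel A)"
proof (rule borel_measurableI_less)
  fix y :: real
  have "L2_open A {g \<in> L2 A. L2_norm A (\<lambda>x. g x - f x) < y}"
    unfolding L2_open_def
  proof (intro conjI ballI)
    fix g assume g: "g \<in> {g \<in> L2 A. L2_norm A (\<lambda>x. g x - f x) < y}"
    have "L2_norm A (\<lambda>x. h x - f x) < y"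
      if "h \<in> L2 A" "L2_norm A (\<lambda>x. h x - g x) < y - L2_norm A (\<lambda>x. g x - f x)" for h
      using L2_norm_triangle[of "\<lambda>x. h x - g x" A "\<lambda>x. g x - f x"] that g f
      by (simp add: L2_diff)
    thus "\<exists>e>0. \<forall>h\<in>L2 A. L2_norm A (\<lambda>x. h x - g x) < e \<longrightarrow> h \<in> {g \<in> L2 A. L2_norm A (\<lambda>x. g x - f x) < y}"
      using g by (intro exI[of _ "y - L2_norm A (\<lambda>x. g x - f x)"]) auto
  qed auto
  thus "{g \<in> space (L2_borel A). L2_norm A (\<lambda>x. g x - f x) < y} \<in> sets (L2_borel A)"
    unfolding space_L2_borel unfolding L2_borel_def
    by (subst sets_measure_of) (auto simp: L2_open_def)
qed

section \<open>Hermite functions\<close>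

text \<open>The recursion is what differentiating \<open>H_j(x) exp (- x^2)\<close> produces, up to
  sign. As formal polynomials, the classical relations become \<open>pderiv\<close>
  identities.\<close>

fun hermite_real_poly :: "nat \<Rightarrow> real poly" where
  "hermite_real_poly 0 = 1"
| "hermite_real_poly (Suc j) = [:0, 2:] * hermite_real_poly j - pderiv (hermite_real_poly j)"

lemma poly_gauss_deriv:
  "((\<lambda>x. poly p x * exp (- x\<^sup>2)) has_real_derivative
     poly (pderiv p - [:0, 2:] * p) x * exp (- x\<^sup>2)) (at x)"
  by (auto intro!: derivative_eq_intros poly_DERIV simp: algebra_simps)

lemma deriv_funpow_gauss:
  "(deriv ^^ j) (\<lambda>y. exp (- y\<^sup>2)) = (\<lambda>x. (-1) ^ j * (poly (hermite_real_poly j) x * exp (- x\<^sup>2)))"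
proof (induction j)
  case (Suc j)
  have "deriv (\<lambda>x. (-1) ^ j * (poly (hermite_real_poly j) x * exp (- x\<^sup>2))) x =
    (-1) ^ j * (poly (pderiv (hermite_real_poly j) - [:0, 2:] * hermite_real_poly j) x * exp (- x\<^sup>2))" for x
    by (intro DERIV_imp_deriv DERIV_cmult poly_gauss_deriv)
  thus ?case using Suc by (auto simp: algebra_simps)
qed simp

lemma hermite_poly_eq: "hermite_poly j x = poly (hermite_real_poly j) x"
proof -
  have "hermite_poly j x =
      ((-1) ^ j * (-1) ^ j) * (exp (x\<^sup>2) * exp (- x\<^sup>2)) * poly (hermite_real_poly j) x"
    by (simp only: hermite_poly_def deriv_funpow_gauss mult_ac)
  thus ?thesis by (simp only: minus_one_mult_self exp_minus_inverse mult_1)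
qed

lemma pderiv_hermite_real_poly:
  "pderiv (hermite_real_poly (Suc j)) = smult (2 * (real j + 1)) (hermite_real_poly j)"
proof (induction j)
  case (Suc j)
  let ?H = hermite_real_poly
  have "pderiv (?H (Suc (Suc j))) = smult 2 (?H (Suc j)) + [:0, 2:] * pderiv (?H (Suc j)) - pderiv (pderiv (?H (Suc j)))"
    by (subst hermite_real_poly.simps)
       (simp add: pderiv_diff pderiv_mult pderiv_pCons pderiv_smult del: hermite_real_poly.simps)
  also have "\<dots> = smult 2 (?H (Suc j)) + smult (2 * (real j + 1)) ([:0, 2:] * ?H j - pderiv (?H j))"
    by (simp only: Suc pderiv_smult) (simp add: algebra_simps smult_diff_right)
  also have "\<dots> = smult (2 * (real (Suc j) + 1)) (?H (Suc j))"
    by (simp add: algebra_simps flip: smult_add_left)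
  finally show ?case .
qed (simp add: pderiv_pCons)

text \<open>Differentiating the recursion gives \<open>H_(j+1)' = 2 H_j + 2 x H_j' - H_j''\<close>;
  equating this with \<open>2 (j + 1) H_j\<close> yields Hermite's equation.\<close>

lemma hermite_ode:
  "pderiv (pderiv (hermite_real_poly j)) = [:0, 2:] * pderiv (hermite_real_poly j) - smult (2 * real j) (hermite_real_poly j)"
proof -
  let ?H = hermite_real_poly
  have "smult (2 * (real j + 1)) (?H j) = smult 2 (?H j) + [:0, 2:] * pderiv (?H j) - pderiv (pderiv (?H j))"
    by (subst pderiv_hermite_real_poly[symmetric]) (simp add: pderiv_diff pderiv_mult pderiv_pCons pderiv_smult algebra_simps)
  thus ?thesis by (simp add: algebra_simps smult_add_left)
qed

section \<open>Orthogonality of the Hermite polynomials under the Gaussian weight\<close>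

lemma integrable_poly_gauss: "integrable lborel (\<lambda>x::real. poly p x * exp (- x\<^sup>2))"
proof -
  have "integrable lborel (\<lambda>x::real. x ^ i * exp (- x\<^sup>2))" for i
  proof -
    have "integrable lborel (\<lambda>x. sqrt pi * (normal_density 0 (1 / sqrt 2) x * (x - 0) ^ i))"
      by (intro integrable_mult_right integrable_normal_moment) simp
    thus ?thesis by (simp add: normal_density_def power_divide mult_ac real_sqrt_divide)
  qed
  hence "integrable lborel (\<lambda>x::real. \<Sum>i\<le>degree p. coeff p i * (x ^ i * exp (- x\<^sup>2)))" by simp
  thus ?thesis by (simp add: poly_altdef sum_distrib_right mult.assoc)
qed

lemma poly_gauss_tendsto_0: "((\<lambda>x. poly p x * exp (- x\<^sup>2)) \<longlongrightarrow> 0) at_top" for p :: "real poly"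
proof (rule Lim_null_comparison)
  have "((\<lambda>y. \<Sum>i\<le>degree p. \<bar>coeff p i\<bar> * (y ^ i / exp y)) \<longlongrightarrow> (\<Sum>i\<le>degree p. \<bar>coeff p i\<bar> * 0)) at_top"
    by (intro tendsto_intros tendsto_power_div_exp_0)
  thus "((\<lambda>y. \<Sum>i\<le>degree p. \<bar>coeff p i\<bar> * (y ^ i / exp y)) \<longlongrightarrow> 0) at_top" by simp
  show "\<forall>\<^sub>F x in at_top. norm (poly p x * exp (- x\<^sup>2)) \<le> (\<Sum>i\<le>degree p. \<bar>coeff p i\<bar> * (x ^ i / exp x))"
  proof (rule eventually_mono[OF eventually_ge_at_top[of 1]])
    fix x :: real assume x: "1 \<le> x"
    have "norm (poly p x * exp (- x\<^sup>2)) = \<bar>\<Sum>i\<le>degree p. coeff p i * x ^ i\<bar> * exp (- x\<^sup>2)"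
      by (simp add: poly_altdef abs_mult)
    also have "\<dots> \<le> (\<Sum>i\<le>degree p. \<bar>coeff p i\<bar> * x ^ i) * exp (- x)"
      using x self_le_power[of x 2]
      by (intro mult_mono order.trans[OF sum_abs] sum_mono sum_nonneg) (auto simp: abs_mult)
    finally show "norm (poly p x * exp (- x\<^sup>2)) \<le> (\<Sum>i\<le>degree p. \<bar>coeff p i\<bar> * (x ^ i / exp x))"
      by (simp add: sum_distrib_right exp_minus field_simps sum_divide_distrib)
  qed
qed

lemma poly_gauss_tendsto_0_bot: "((\<lambda>x. poly p x * exp (- x\<^sup>2)) \<longlongrightarrow> 0) at_bot" for p :: "real poly"
  using poly_gauss_tendsto_0[of "pcompose p [:0, -1:]"]
  by (simp add: filterlim_at_bot_mirror poly_pcompose)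

lemma integral_deriv_poly_gauss:
  "(LINT x|lborel. poly (pderiv p - [:0, 2:] * p) x * exp (- x\<^sup>2)) = 0" for p :: "real poly"
proof -
  have "(LBINT x=-\<infinity>..\<infinity>. poly (pderiv p - [:0, 2:] * p) x * exp (- x\<^sup>2)) = 0 - 0"
  proof (rule interval_integral_FTC_integrable)
    show "set_integrable lborel (einterval (- \<infinity>) \<infinity>) (\<lambda>x. poly (pderiv p - [:0, 2:] * p) x * exp (- x\<^sup>2))"
      using integrable_poly_gauss[of "pderiv p - [:0, 2:] * p"]
      unfolding set_integrable_def by simp
    show "(((\<lambda>x. poly p x * exp (- x\<^sup>2)) \<circ> real_of_ereal) \<longlongrightarrow> 0) (at_right (- \<infinity>))"
      unfolding ereal_tendsto_simps by (rule poly_gauss_tendsto_0_bot)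
    show "(((\<lambda>x. poly p x * exp (- x\<^sup>2)) \<circ> real_of_ereal) \<longlongrightarrow> 0) (at_left \<infinity>)"
      unfolding ereal_tendsto_simps by (rule poly_gauss_tendsto_0)
  qed (use poly_gauss_deriv[of p] in \<open>auto simp: has_real_derivative_iff_has_vector_derivative intro!: continuous_intros\<close>)
  thus ?thesis by (simp add: interval_lebesgue_integral_def set_lebesgue_integral_def)
qed

definition gauss_integral :: "real poly \<Rightarrow> real" where
  "gauss_integral p = (LINT x|lborel. poly p x * exp (- x\<^sup>2))"

text \<open>\<open>q H_j exp (- x^2)\<close> has derivative
  \<open>(q' H_j - q H_(j+1)) exp (- x^2)\<close>, whose integral over the line vanishes.\<close>

lemma gauss_integral_by_parts:
  "gauss_integral (q * hermite_real_poly (Suc j)) = gauss_integral (pderiv q * hermite_real_poly j)"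
proof -
  let ?H = hermite_real_poly
  have "0 = gauss_integral (pderiv (q * ?H j) - [:0, 2:] * (q * ?H j))"
    unfolding gauss_integral_def by (rule integral_deriv_poly_gauss[symmetric])
  also have "pderiv (q * ?H j) - [:0, 2:] * (q * ?H j) = pderiv q * ?H j - q * ?H (Suc j)"
    by (simp add: pderiv_mult algebra_simps)
  also have "gauss_integral \<dots> = gauss_integral (pderiv q * ?H j) - gauss_integral (q * ?H (Suc j))"
    unfolding gauss_integral_def poly_diff left_diff_distrib
    by (rule Bochner_Integration.integral_diff) (rule integrable_poly_gauss)+
  finally show ?thesis by simp
qed

text \<open>Integration by parts lowers both indices by one and contributes
  \<open>2 (i + 1)\<close>, since \<open>H_(i+1)' = 2 (i + 1) H_i\<close>. Unequal indices end with
  the derivative of the constant polynomial 1.\<close>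

lemma gauss_integral_hermite:
  "gauss_integral (hermite_real_poly i * hermite_real_poly j) =
     (if i = j then 2 ^ j * fact j * sqrt pi else 0)"
proof (induction i arbitrary: j)
  case 0
  show ?case
  proof (cases j)
    case 0
    have "(LINT x|lborel. sqrt pi * normal_density 0 (1 / sqrt 2) x) = sqrt pi * 1"
      by simp
    thus ?thesis using 0
      by (simp add: gauss_integral_def normal_density_def power_divide mult_ac real_sqrt_divide)
  next
    case (Suc k)
    thus ?thesis using gauss_integral_by_parts[of 1 k] by (simp add: gauss_integral_def)
  qed
next
  case (Suc i)
  show ?case
  proof (cases j)
    case 0
    thus ?thesis using gauss_integral_by_parts[of 1 i]
      by (simp add: gauss_integral_def del: hermite_real_poly.simps(2))
  next
    case (Suc k)
    have "gauss_integral (hermite_real_poly (Suc i) * hermite_real_poly (Suc k)) =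
      2 * (real i + 1) * gauss_integral (hermite_real_poly i * hermite_real_poly k)"
      by (simp only: gauss_integral_by_parts pderiv_hermite_real_poly)
         (simp add: gauss_integral_def mult.assoc)
    thus ?thesis using Suc Suc.IH[of k] by (simp del: hermite_real_poly.simps(2))
  qed
qed

section \<open>Laguerre polynomials\<close>

text \<open>The difference \<open>j - n\<close> is taken in the reals, so the identity also covers
  \<open>n > j\<close>, where both binomials are 0, and coefficients can be compared without
  distinguishing degrees.\<close>

lemma Suc_times_binomial_real:
  "real (Suc n) * real (j choose Suc n) = (real j - real n) * real (j choose n)"
proof (induction j arbitrary: n)
  case (Suc j)
  show ?case
  proof (cases n)
    case (Suc m)
    have "real (Suc n) * real (Suc j choose Suc n) =
        real (Suc n) * real (j choose n) + real (Suc n) * real (j choose Suc n)"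
      by (simp add: algebra_simps)
    also have "\<dots> = (real j + 1) * real (j choose n)"
      unfolding Suc.IH by (simp add: algebra_simps)
    also have "\<dots> = (real j - real m) * real (j choose m) + (real j - real m) * real (j choose Suc m)"
      using Suc.IH[of m] Suc by (simp add: algebra_simps)
    also have "\<dots> = (real (Suc j) - real n) * real (Suc j choose n)"
      using Suc by (simp add: algebra_simps)
    finally show ?thesis .
  qed simp
qed auto

definition laguerre_real_poly :: "nat \<Rightarrow> real poly" where
  "laguerre_real_poly j = (\<Sum>k\<le>j. monom ((-1) ^ k * real (j choose k) / fact k) k)"

lemma laguerre_poly_eq: "laguerre_poly j x = poly (laguerre_real_poly j) x"
  by (simp add: laguerre_poly_def laguerre_real_poly_def poly_sum poly_monom)

lemma coeff_laguerre: "coeff (laguerre_real_poly j) k = (-1) ^ k * real (j choose k) / fact k"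
  by (auto simp: laguerre_real_poly_def coeff_sum)

lemma coeff_laguerre_Suc:
  "real (Suc n) * coeff (laguerre_real_poly j) (Suc n) = - ((-1) ^ n / fact n * real (j choose Suc n))"
proof -
  have "real (Suc n) * coeff (laguerre_real_poly j) (Suc n) =
      (real (Suc n) / fact (Suc n)) * ((-1) ^ Suc n * real (j choose Suc n))"
    by (simp add: coeff_laguerre)
  also have "real (Suc n) / fact (Suc n) = 1 / fact n"
    by (simp add: fact_Suc del: of_nat_Suc)
  finally show ?thesis by simp
qed

text \<open>Laguerre's equation \<open>x L'' + (1 - x) L' + j L = 0\<close>. Its coefficient at
  \<open>x^n\<close> is the two-term recurrence \<open>(n + 1)^2 c_(n+1) + (j - n) c_n = 0\<close>,
  which reduces to the binomial identity above.\<close>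

lemma laguerre_ode:
  "[:0, 1:] * pderiv (pderiv (laguerre_real_poly j)) + [:1, -1:] * pderiv (laguerre_real_poly j)
     + smult (real j) (laguerre_real_poly j) = 0"
proof (rule poly_eqI)
  fix n
  let ?c = "coeff (laguerre_real_poly j)"
  have rec: "(real n + 1)\<^sup>2 * ?c (Suc n) + (real j - real n) * ?c n = 0"
  proof -
    have "(real n + 1)\<^sup>2 * ?c (Suc n) = real (Suc n) * (real (Suc n) * ?c (Suc n))"
      by (simp add: power2_eq_square add.commute)
    also have "\<dots> = - ((-1) ^ n / fact n * (real (Suc n) * real (j choose Suc n)))"
      unfolding coeff_laguerre_Suc by simp
    finally have "(real n + 1)\<^sup>2 * ?c (Suc n) = - ((-1) ^ n / fact n * (real (Suc n) * real (j choose Suc n)))" .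
    thus ?thesis
      unfolding Suc_times_binomial_real by (simp add: coeff_laguerre)
  qed
  show "coeff ([:0, 1:] * pderiv (pderiv (laguerre_real_poly j)) + [:1, -1:] * pderiv (laguerre_real_poly j)
     + smult (real j) (laguerre_real_poly j)) n = coeff 0 n"
    using rec by (cases n) (simp_all add: coeff_pderiv algebra_simps power2_eq_square)
qed

text \<open>Coefficientwise this is Pascal's rule.\<close>

lemma pderiv_laguerre_diff:
  "pderiv (laguerre_real_poly (Suc j) - laguerre_real_poly j) = - laguerre_real_poly j"
proof (rule poly_eqI)
  fix n
  show "coeff (pderiv (laguerre_real_poly (Suc j) - laguerre_real_poly j)) n = coeff (- laguerre_real_poly j) n"
    by (simp add: coeff_pderiv coeff_laguerre_Suc right_diff_distrib del: of_nat_Suc)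
       (simp add: coeff_laguerre add_divide_distrib distrib_left)
qed

section \<open>Orthogonality of the Laguerre polynomials under the exponential weight\<close>

lemma poly_laguerre_0: "poly (laguerre_real_poly j) 0 = 1"
  by (simp add: poly_0_coeff_0 coeff_laguerre)

text \<open>The integral of \<open>p(y) exp (- y)\<close> over \<open>y > 0\<close>, written with
  \<open>y = 2 x\<close>. In this form the integrand is exactly a product of two Laguerre functions
  when \<open>p\<close> is the product of their polynomials.\<close>

definition exp_integral :: "real poly \<Rightarrow> real" where
  "exp_integral p = (LINT x|lborel_on {0<..}. 2 * (poly p (2 * x) * exp (- (2 * x))))"

lemma integrable_poly_exp:
  "integrable (lborel_on {0<..}) (\<lambda>x::real. 2 * (poly p (2 * x) * exp (- (2 * x))))"
proof -
  \<comment> \<open>Up to a constant the integrand is the Erlang density of rate 2, which has total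
    mass 1.\<close>
  have "integrable (lborel_on {0<..}) (\<lambda>x::real. x ^ i * exp (- (2 * x)))" for i
  proof -
    interpret prob_space "density lborel (\<lambda>x. ennreal (erlang_density i 2 x))"
      by (rule prob_space_erlang_density) simp
    have "integrable lborel (erlang_density i 2)"
    proof (rule integrableI_nonneg)
      have "(\<integral>\<^sup>+ x. ennreal (erlang_density i 2 x) \<partial>lborel) = 1"
        using emeasure_space_1 by (simp add: emeasure_density)
      thus "(\<integral>\<^sup>+ x. ennreal (erlang_density i 2 x) \<partial>lborel) < \<infinity>" by simp
    qed auto
    hence "integrable lborel (\<lambda>x. indicator {0<..} x *\<^sub>R (fact i / 2 ^ Suc i * erlang_density i 2 x))"
      by (intro integrable_mult_indicator integrable_mult_right) auto
    also have "(\<lambda>x. indicator {0<..} x *\<^sub>R (fact i / 2 ^ Suc i * erlang_density i 2 x)) =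
        (\<lambda>x. indicator {0<..} x *\<^sub>R (x ^ i * exp (- (2 * x))))"
      by (auto simp: erlang_density_def fun_eq_iff indicator_def)
    finally show ?thesis
      by (subst integrable_restrict_space) auto
  qed
  hence "integrable (lborel_on {0<..})
      (\<lambda>x::real. \<Sum>i\<le>degree p. (2 * coeff p i * 2 ^ i) * (x ^ i * exp (- (2 * x))))"
    by (intro Bochner_Integration.integrable_sum integrable_mult_right) auto
  thus ?thesis
    by (simp add: poly_altdef sum_distrib_left sum_distrib_right power_mult_distrib mult_ac)
qed

lemma poly_exp_tendsto_0: "((\<lambda>x. poly p (2 * x) * exp (- (2 * x))) \<longlongrightarrow> 0) at_top" for p :: "real poly"
proof -
  have "((\<lambda>y. \<Sum>i\<le>degree p. coeff p i * (y ^ i / exp y)) \<longlongrightarrow> (\<Sum>i\<le>degree p. coeff p i * 0)) at_top"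
    by (intro tendsto_intros tendsto_power_div_exp_0)
  hence "((\<lambda>y. poly p y * exp (- y)) \<longlongrightarrow> 0) at_top"
    by (simp add: poly_altdef sum_divide_distrib exp_minus field_simps)
  moreover have "filterlim (\<lambda>x::real. 2 * x) at_top at_top"
    by (intro filterlim_tendsto_pos_mult_at_top[OF tendsto_const] filterlim_ident) auto
  ultimately show ?thesis by (rule filterlim_compose)
qed

text \<open>Integration by parts; unlike for the Gaussian weight on the whole line, a boundary term
  at 0 survives.\<close>

lemma exp_integral_pderiv: "exp_integral p = exp_integral (pderiv p) + poly p 0"
proof -
  let ?f = "\<lambda>q x. 2 * (poly q (2 * x) * exp (- (2 * x)))"
  have "(LBINT x=0..\<infinity>. ?f (p - pderiv p) x) = 0 - (- poly p 0)"
  proof (rule interval_integral_FTC_integrable)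
    show "set_integrable lborel (einterval 0 \<infinity>) (?f (p - pderiv p))"
      using integrable_poly_exp[of "p - pderiv p"]
      by (subst (asm) integrable_restrict_space) (auto simp: set_integrable_def einterval_def greaterThan_def zero_ereal_def)
    show "(((\<lambda>x. - (poly p (2 * x) * exp (- (2 * x)))) \<circ> real_of_ereal) \<longlongrightarrow> 0) (at_left \<infinity>)"
      unfolding ereal_tendsto_simps using tendsto_minus[OF poly_exp_tendsto_0[of p]] by simp
    have "((\<lambda>x. - (poly p (2 * x) * exp (- (2 * x)))) \<longlongrightarrow> - (poly p (2 * 0) * exp (- (2 * 0)))) (at_right 0)"
      by (intro tendsto_intros)
    thus "(((\<lambda>x. - (poly p (2 * x) * exp (- (2 * x)))) \<circ> real_of_ereal) \<longlongrightarrow> - poly p 0) (at_right 0)"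
      unfolding zero_ereal_def ereal_tendsto_simps by simp
    show "((\<lambda>x. - (poly p (2 * x) * exp (- (2 * x)))) has_vector_derivative ?f (p - pderiv p) x) (at x)" for x
      unfolding has_real_derivative_iff_has_vector_derivative[symmetric]
      by (auto intro!: derivative_eq_intros poly_DERIV[THEN DERIV_chain2] simp: algebra_simps)
  qed (auto intro!: continuous_intros)
  also have "(LBINT x=0..\<infinity>. ?f (p - pderiv p) x) = exp_integral (p - pderiv p)"
    by (auto simp: exp_integral_def interval_lebesgue_integral_def set_lebesgue_integral_def
        einterval_def greaterThan_def integral_restrict_space zero_ereal_def)
  also have "\<dots> = exp_integral p - exp_integral (pderiv p)"
    unfolding exp_integral_def poly_diff left_diff_distrib right_diff_distrib
    by (rule Bochner_Integration.integral_diff) (rule integrable_poly_exp)+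
  finally show ?thesis by simp
qed

lemma exp_integral_diff: "exp_integral (p - q) = exp_integral p - exp_integral q"
  unfolding exp_integral_def poly_diff left_diff_distrib right_diff_distrib
  by (rule Bochner_Integration.integral_diff) (rule integrable_poly_exp)+

lemma exp_integral_uminus: "exp_integral (- p) = - exp_integral p"
  using exp_integral_diff[of 0 p] by (simp add: exp_integral_def)

text \<open>With \<open>M\<^sub>j = L\<^sub>j\<^sub>+\<^sub>1 - L\<^sub>j\<close> one has \<open>M\<^sub>j' = - L\<^sub>j\<close> and \<open>M\<^sub>j(0) = 0\<close>; integrating \<open>M\<^sub>i M\<^sub>j\<close> by parts shows that
  the Gram matrix is constant along diagonals.\<close>

lemma exp_integral_laguerre:
  "exp_integral (laguerre_real_poly i * laguerre_real_poly j) = (if i = j then 1 else 0)"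
proof -
  let ?L = laguerre_real_poly
  let ?g = "\<lambda>i j. exp_integral (?L i * ?L j)"
  define M where "M j = ?L (Suc j) - ?L j" for j
  have M: "pderiv (M j) = - ?L j" "poly (M j) 0 = 0" for j
    by (simp_all add: M_def pderiv_laguerre_diff poly_laguerre_0)
  have L0: "?L 0 = 1" by (simp add: laguerre_real_poly_def monom_0)
  have zero: "?g 0 (Suc j) = 0" for j
    using exp_integral_pderiv[of "M j"] unfolding M
    by (simp add: L0 M_def exp_integral_diff exp_integral_uminus)
  have diag: "?g (Suc i) (Suc j) = ?g i j" for i j
  proof -
    have lin: "exp_integral (M i * p) = exp_integral (?L (Suc i) * p) - exp_integral (?L i * p)" for i p
      by (simp add: M_def left_diff_distrib exp_integral_diff)
    have lin': "exp_integral (p * M j) = exp_integral (p * ?L (Suc j)) - exp_integral (p * ?L j)" for j p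
      by (simp add: M_def right_diff_distrib exp_integral_diff)
    \<comment> \<open>Expanded, both sides contain the mixed entries \<open>?g (Suc i) j\<close> and
      \<open>?g i (Suc j)\<close> with coefficient -1; they cancel and leave the two diagonal
      neighbours.\<close>
    have "exp_integral (M i * M j) = exp_integral (- (M i * ?L j) - M j * ?L i)"
      using exp_integral_pderiv[of "M i * M j"] by (simp add: pderiv_mult M)
    also have "\<dots> = - exp_integral (M i * ?L j) - exp_integral (M j * ?L i)"
      by (simp only: exp_integral_diff exp_integral_uminus)
    finally show ?thesis
      unfolding lin lin' by (simp add: mult.commute)
  qed
  have one: "?g 0 0 = 1"
    using exp_integral_pderiv[of 1] by (simp add: L0 pderiv_1) (simp add: exp_integral_def)
  show ?thesis
  proof (induction i arbitrary: j)
    case 0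
    show ?case using one zero by (cases j) auto
  next
    case (Suc i)
    show ?case using Suc diag zero[of i] by (cases j) (auto simp: mult.commute)
  qed
qed

section \<open>Orthonormality and the eigenvalue equation\<close>

lemma dom_of_sets [measurable, simp]: "dom_of c \<in> sets borel"
  by (cases c) auto

lemma dom_of_Icc: "x \<in> {1..2} \<Longrightarrow> x \<in> dom_of c"
  by (cases c) auto

lemma lborel_on_UNIV: "lborel_on UNIV = lborel"
  by (rule measure_eqI) (auto simp: sets_restrict_space emeasure_restrict_space)

lemma hermite_fun_eq:
  "hermite_fun j = (\<lambda>x. (2 ^ j * fact j * sqrt pi) powr (-1/2) * poly (hermite_real_poly j) x * exp (- x\<^sup>2 / 2))"
  by (simp add: hermite_fun_def hermite_poly_eq fun_eq_iff)

lemma hermite_fun_mult: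
  "hermite_fun i x * hermite_fun j x =
     (2 ^ i * fact i * sqrt pi) powr (-1/2) * (2 ^ j * fact j * sqrt pi) powr (-1/2)
       * (poly (hermite_real_poly i * hermite_real_poly j) x * exp (- x\<^sup>2))"
proof -
  have "exp (- x\<^sup>2 / 2) * exp (- x\<^sup>2 / 2) = exp (- x\<^sup>2)"
    by (simp flip: exp_add)
  thus ?thesis by (simp add: hermite_fun_def hermite_poly_eq mult_ac)
qed

lemma laguerre_fun_pos: "0 < x \<Longrightarrow> laguerre_fun j x = sqrt 2 * poly (laguerre_real_poly j) (2 * x) * exp (- x)"
  by (simp add: laguerre_fun_def laguerre_poly_eq)

lemma laguerre_fun_mult:
  assumes "0 < x"
  shows "laguerre_fun i x * laguerre_fun j x =
    2 * (poly (laguerre_real_poly i * laguerre_real_poly j) (2 * x) * exp (- (2 * x)))"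
proof -
  have "exp (- x) * exp (- x) = exp (- (2 * x))" by (simp flip: exp_add)
  moreover have "sqrt 2 * (sqrt 2 * y) = 2 * y" for y by (simp flip: mult.assoc)
  ultimately show ?thesis using assms by (simp add: laguerre_fun_pos mult_ac)
qed

lemma basis_in_L2: "basis_of c j \<in> L2 (dom_of c)"
proof (cases c)
  case Laguerre
  have "laguerre_fun j \<in> borel_measurable borel"
    unfolding laguerre_fun_def laguerre_poly_def by measurable
  hence "laguerre_fun j \<in> borel_measurable (lborel_on {0<..})"
    by (intro measurable_restrict_space1) simp
  moreover have "integrable (lborel_on {0<..}) (\<lambda>x. (laguerre_fun j x)\<^sup>2)"
    by (rule Bochner_Integration.integrable_cong[THEN iffD1, OF refl _ integrable_poly_exp[of "laguerre_real_poly j * laguerre_real_poly j"]])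
       (simp add: power2_eq_square laguerre_fun_mult space_restrict_space)
  ultimately show ?thesis using Laguerre by (simp add: L2_def)
next
  case Hermite
  have "continuous_on UNIV (hermite_fun j)"
    unfolding hermite_fun_eq by (intro continuous_intros) simp_all
  hence "hermite_fun j \<in> borel_measurable lborel"
    by (simp add: borel_measurable_continuous_onI)
  hence "hermite_fun j \<in> borel_measurable (lborel_on UNIV)"
    by (rule measurable_restrict_space1)
  moreover have "integrable lborel (\<lambda>x. hermite_fun j x * hermite_fun j x)"
    unfolding hermite_fun_mult by (intro integrable_mult_right integrable_poly_gauss)
  ultimately show ?thesis using Hermite by (simp add: L2_def power2_eq_square lborel_on_UNIV)
qed

lemma basis_orthonormal:
  "L2_inner (dom_of c) (basis_of c i) (basis_of c j) = (if i = j then 1 else 0)"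
proof (cases c)
  case Laguerre
  have "L2_inner {0<..} (laguerre_fun i) (laguerre_fun j) =
      exp_integral (laguerre_real_poly i * laguerre_real_poly j)"
    unfolding L2_inner_def exp_integral_def
    by (rule Bochner_Integration.integral_cong) (auto simp: laguerre_fun_mult space_restrict_space)
  thus ?thesis using Laguerre by (simp add: exp_integral_laguerre)
next
  case Hermite
  let ?w = "\<lambda>j. 2 ^ j * fact j * sqrt pi"
  have "?w j powr (-1/2) * ?w j powr (-1/2) * ?w j = 1"
  proof -
    have "?w j > 0" by simp
    hence "?w j powr (-1/2) * ?w j powr (-1/2) * ?w j powr 1 = 1"
      by (simp only: flip: powr_add) simp
    thus ?thesis by simp
  qed
  moreover have "L2_inner UNIV (hermite_fun i) (hermite_fun j) =
      ?w i powr (-1/2) * ?w j powr (-1/2) * gauss_integral (hermite_real_poly i * hermite_real_poly j)"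
    unfolding L2_inner_def gauss_integral_def hermite_fun_mult lborel_on_UNIV by simp
  ultimately show ?thesis using Hermite by (simp add: gauss_integral_hermite)
qed

text \<open>The basis functions are eigenfunctions of \<open>f \<mapsto> - (P f')' + Q f\<close> with eigenvalues \<open>2 j + 1\<close>.\<close>

fun sl_P :: "basis_case \<Rightarrow> real \<Rightarrow> real" where
  "sl_P Laguerre x = x"
| "sl_P Hermite x = 1"

fun sl_Q :: "basis_case \<Rightarrow> real \<Rightarrow> real" where
  "sl_Q Laguerre x = x"
| "sl_Q Hermite x = x\<^sup>2"

text \<open>The polynomial differential equations, rewritten for the weighted functions. The claim
  is made for \<open>x > 0\<close>, away from the jump that the indicator causes in
  \<open>laguerre_fun\<close> at 0; this contains \<open>[1, 2]\<close>. The derivative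
  \<open>d\<close> is exposed because it enters the boundary terms of Green's identity.\<close>

lemma basis_eigenfunction:
  "\<exists>d. \<forall>x>0. (basis_of c j has_real_derivative d x) (at x) \<and>
    ((\<lambda>x. sl_P c x * d x) has_real_derivative (sl_Q c x - (2 * real j + 1)) * basis_of c j x) (at x)"
proof (cases c)
  case Laguerre
  let ?L = "laguerre_real_poly j"
  let ?d = "\<lambda>x. sqrt 2 * (poly (smult 2 (pderiv ?L) - ?L) (2 * x) * exp (- x))"
  have "(laguerre_fun j has_real_derivative ?d x) (at x)" if "x > 0" for x
  proof (rule has_field_derivative_transform_within_open[of _ _ _ "{0<..}"])
    show "((\<lambda>x. sqrt 2 * poly ?L (2 * x) * exp (- x)) has_real_derivative ?d x) (at x)"
      by (auto intro!: derivative_eq_intros poly_DERIV[THEN DERIV_chain2] simp: algebra_simps)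
  qed (use that in \<open>auto simp: laguerre_fun_pos\<close>)
  moreover have "((\<lambda>x. x * ?d x) has_real_derivative (x - (2 * real j + 1)) * laguerre_fun j x) (at x)"
    if "x > 0" for x
  proof -
    have ode: "2 * x * poly (pderiv (pderiv ?L)) (2 * x) =
        (2 * x - 1) * poly (pderiv ?L) (2 * x) - real j * poly ?L (2 * x)"
      using arg_cong[OF laguerre_ode[of j], of "\<lambda>p. poly p (2 * x)"] by (simp add: algebra_simps)
    have "((\<lambda>x. x * ?d x) has_real_derivative
       sqrt 2 * exp (- x) * (2 * (2 * x * poly (pderiv (pderiv ?L)) (2 * x))
         + (2 - 4 * x) * poly (pderiv ?L) (2 * x) + (x - 1) * poly ?L (2 * x))) (at x)"
      by (auto intro!: derivative_eq_intros poly_DERIV[THEN DERIV_chain2] simp: pderiv_diff pderiv_smult algebra_simps)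
    thus ?thesis using that unfolding ode
      by (simp add: laguerre_fun_pos algebra_simps)
  qed
  ultimately show ?thesis using Laguerre by (intro exI[of _ ?d]) auto
next
  case Hermite
  let ?H = "hermite_real_poly j"
  let ?w = "(2 ^ j * fact j * sqrt pi) powr (-1/2)"
  let ?d = "\<lambda>x. ?w * (poly (pderiv ?H - [:0, 1:] * ?H) x * exp (- x\<^sup>2 / 2))"
  have "(hermite_fun j has_real_derivative ?d x) (at x)" for x
    unfolding hermite_fun_eq by (auto intro!: derivative_eq_intros poly_DERIV simp: algebra_simps)
  moreover have "(?d has_real_derivative (x\<^sup>2 - (2 * real j + 1)) * hermite_fun j x) (at x)" for x
  proof -
    have ode: "poly (pderiv (pderiv ?H)) x = 2 * x * poly (pderiv ?H) x - 2 * real j * poly ?H x"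
      by (subst hermite_ode) (simp add: algebra_simps)
    have "(?d has_real_derivative ?w * exp (- x\<^sup>2 / 2) *
       (poly (pderiv (pderiv ?H)) x - 2 * x * poly (pderiv ?H) x + (x\<^sup>2 - 1) * poly ?H x)) (at x)"
      by (auto intro!: derivative_eq_intros poly_DERIV
           simp: pderiv_diff pderiv_mult pderiv_pCons algebra_simps power2_eq_square)
    thus ?thesis unfolding ode by (simp add: hermite_fun_eq algebra_simps)
  qed
  ultimately show ?thesis using Hermite by (intro exI[of _ ?d]) auto
qed

section \<open>Sobolev bounds for oscillating families\<close>

lemma integral_dom_of_supported:
  assumes "\<And>x. x \<notin> {1..2} \<Longrightarrow> w x = 0"
  shows "(LINT x|lborel_on (dom_of c). w x) = (LINT x|lborel. indicator {1..2} x *\<^sub>R (w x :: real))"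
proof -
  have "(LINT x|lborel_on (dom_of c). w x) = (LINT x|lborel. indicator (dom_of c) x *\<^sub>R w x)"
    by (rule integral_restrict_space) auto
  also have "\<dots> = (LINT x|lborel. indicator {1..2} x *\<^sub>R w x)"
    using assms dom_of_Icc by (intro Bochner_Integration.integral_cong) (auto simp: indicator_def)
  finally show ?thesis .
qed

lemma integrable_dom_of_supported:
  fixes w :: "real \<Rightarrow> real"
  assumes "continuous_on {1..2} w" "\<And>x. x \<notin> {1..2} \<Longrightarrow> w x = 0"
  shows "integrable (lborel_on (dom_of c)) w"
proof -
  have "integrable lborel (\<lambda>x. indicator {1..2} x *\<^sub>R w x)"
    using borel_integrable_atLeastAtMost'[OF assms(1)] by (simp add: set_integrable_def)
  also have "(\<lambda>x. indicator {1..2} x *\<^sub>R w x) = (\<lambda>x. indicator (dom_of c) x *\<^sub>R w x)"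
    using assms(2) dom_of_Icc by (auto simp: indicator_def fun_eq_iff)
  finally show ?thesis by (subst integrable_restrict_space) auto
qed

lemma L2_supported:
  fixes w :: "real \<Rightarrow> real"
  assumes "continuous_on {1..2} w" "\<And>x. x \<notin> {1..2} \<Longrightarrow> w x = 0"
  shows "w \<in> L2 (dom_of c)"
proof (rule L2_I)
  show "w \<in> borel_measurable (lborel_on (dom_of c))"
    using integrable_dom_of_supported[OF assms] by (rule borel_measurable_integrable)
  show "integrable (lborel_on (dom_of c)) (\<lambda>x. (w x)\<^sup>2)"
    using assms by (intro integrable_dom_of_supported continuous_intros) auto
qed

lemma L2_inner_self_supported_le:
  assumes "continuous_on {1..2} w" "\<And>x. x \<notin> {1..2} \<Longrightarrow> w x = 0" "\<And>x. x \<in> {1..2} \<Longrightarrow> \<bar>w x\<bar> \<le> B"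
  shows "L2_inner (dom_of c) w w \<le> B\<^sup>2"
proof -
  have "L2_inner (dom_of c) w w = (LINT x|lborel. indicator {1..2} x *\<^sub>R (w x * w x))"
    unfolding L2_inner_def using assms(2) by (intro integral_dom_of_supported) simp
  also have "\<dots> \<le> (LINT x|lborel. indicator {1..2::real} x *\<^sub>R B\<^sup>2)"
  proof (rule integral_mono)
    show "integrable lborel (\<lambda>x. indicator {1..2} x *\<^sub>R (w x * w x))"
      using borel_integrable_atLeastAtMost'[of 1 2 "\<lambda>x. w x * w x"] assms(1)
      by (simp add: set_integrable_def continuous_on_mult)
    show "indicator {1..2} x *\<^sub>R (w x * w x) \<le> indicator {1..2} x *\<^sub>R B\<^sup>2" for x
      using abs_le_square_iff[of "w x" B] assms(3)[of x] by (auto simp: indicator_def power2_eq_square)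
  qed auto
  also have "\<dots> = B\<^sup>2" by simp
  finally show ?thesis .
qed

text \<open>Here \<open>v\<close> is \<open>T u\<close>. With \<open>e\<close> the basis function,
  the Wronskian expression \<open>P (u e' - u' e)\<close> has derivative
  \<open>(v - (2 j + 1) u) e\<close>, and it vanishes at 1 and 2 because \<open>u\<close> and
  \<open>u'\<close> do.\<close>

lemma greens_identity:
  assumes u: "\<And>x. x \<in> {1..2} \<Longrightarrow> (u has_real_derivative u' x) (at x)"
    and v: "\<And>x. x \<in> {1..2} \<Longrightarrow> ((\<lambda>x. sl_P c x * u' x) has_real_derivative (sl_Q c x * u x - v x)) (at x)"
    and "continuous_on {1..2} v"
    and bd: "u 1 = 0" "u 2 = 0" "u' 1 = 0" "u' 2 = 0"
    and off: "\<And>x. x \<notin> {1..2} \<Longrightarrow> u x = 0" "\<And>x. x \<notin> {1..2} \<Longrightarrow> v x = 0"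
  shows "basis_coeff c j v = (2 * real j + 1) * basis_coeff c j u"
proof -
  obtain d where d: "\<And>x. 0 < x \<Longrightarrow> (basis_of c j has_real_derivative d x) (at x)"
    "\<And>x. 0 < x \<Longrightarrow> ((\<lambda>x. sl_P c x * d x) has_real_derivative (sl_Q c x - (2 * real j + 1)) * basis_of c j x) (at x)"
    using basis_eigenfunction[of c j] by blast
  let ?w = "\<lambda>x. (v x - (2 * real j + 1) * u x) * basis_of c j x"
  let ?F = "\<lambda>x. u x * (sl_P c x * d x) - sl_P c x * u' x * basis_of c j x"
  have cont: "continuous_on {1..2} (basis_of c j)" "continuous_on {1..2} u"
    by (auto intro!: continuous_at_imp_continuous_on DERIV_isCont[OF d(1)] DERIV_isCont[OF u])
  have "(LINT x|lborel. indicator {1..2} x *\<^sub>R ?w x) = ?F 2 - ?F 1"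
  proof (rule integral_FTC_atLeastAtMost)
    show "continuous_on {1..2} ?w"
      by (intro continuous_intros cont assms)
    fix x :: real assume x: "1 \<le> x" "x \<le> 2"
    have "(?F has_real_derivative u x * ((sl_Q c x - (2 * real j + 1)) * basis_of c j x) + u' x * (sl_P c x * d x) -
        (sl_P c x * u' x * d x + (sl_Q c x * u x - v x) * basis_of c j x)) (at x)"
      by (rule derivative_intros DERIV_mult' d u v | use x in simp)+
    also have "u x * ((sl_Q c x - (2 * real j + 1)) * basis_of c j x) + u' x * (sl_P c x * d x) -
        (sl_P c x * u' x * d x + (sl_Q c x * u x - v x) * basis_of c j x) = ?w x"
      by (simp add: algebra_simps)
    finally show "(?F has_vector_derivative ?w x) (at x within {1..2})"
      unfolding has_real_derivative_iff_has_vector_derivative[symmetric]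
      by (rule has_field_derivative_at_within)
  qed simp
  hence "0 = L2_inner (dom_of c) (\<lambda>x. v x - (2 * real j + 1) * u x) (basis_of c j)"
    unfolding L2_inner_def using off bd by (subst integral_dom_of_supported) auto
  also have "\<dots> = basis_coeff c j v - (2 * real j + 1) * basis_coeff c j u"
    unfolding basis_coeff_def
    by (subst L2_inner_diff_left)
       (auto intro!: L2_scale L2_supported basis_in_L2 assms cont simp: L2_inner_scale_left)
  finally show ?thesis by simp
qed

text \<open>Multiplication by \<open>P\<close> and \<open>Q\<close>, which are powers of
  \<open>x\<close>, costs no power of \<open>K\<close>; the two derivatives cost one each. The
  family \<open>v\<close> is \<open>T u\<close>.\<close>

lemma osc_sl_operator:
  assumes "osc r u"
  shows "\<exists>u' v. osc (Suc r) u' \<and> osc (r + 2) v \<and>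
    (\<forall>K t x. (u K t has_real_derivative u' K t x) (at x)) \<and>
    (\<forall>K t x. ((\<lambda>x. sl_P c x * u' K t x) has_real_derivative (sl_Q c x * u K t x - v K t x)) (at x))"
proof -
  obtain u' where u': "osc (Suc r) u'" "\<And>K t x. (u K t has_real_derivative u' K t x) (at x)"
    using osc_deriv[OF assms] by blast
  have "osc (Suc r) (\<lambda>K t x. sl_P c x * u' K t x)"
    using u'(1) osc_mult_ident[OF u'(1)] by (cases c) auto
  then obtain u'' where u'': "osc (r + 2) u''"
    "\<And>K t x. ((\<lambda>x. sl_P c x * u' K t x) has_real_derivative u'' K t x) (at x)"
    using osc_deriv by fastforce
  have "osc r (\<lambda>K t x. sl_Q c x * u K t x)"
    using osc_mult_ident[OF assms] osc_mult_ident[OF osc_mult_ident[OF assms]]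
    by (cases c) (auto simp: power2_eq_square mult.assoc)
  hence "osc (r + 2) (\<lambda>K t x. sl_Q c x * u K t x + (-1) * u'' K t x)"
    by (intro osc.add osc_scale u'' osc_mono[of r _ "r + 2"]) auto
  thus ?thesis
    using u' u''(2) by (intro exI[of _ u'] exI[of _ "\<lambda>K t x. sl_Q c x * u K t x + (-1) * u'' K t x"]) auto
qed

text \<open>The rescaled copy lives inside \<open>(1, 2)\<close>, so it and its derivatives vanish
  at 1 and 2 and Green's identity has no boundary terms.\<close>

definition admissible :: "real \<Rightarrow> real \<Rightarrow> bool" where
  "admissible K t \<longleftrightarrow> (\<forall>x. K * x - t \<in> {1<..<2} \<longrightarrow> x \<in> {1<..<2})"

lemma osc_eq_0_admissible: "osc r u \<Longrightarrow> admissible K t \<Longrightarrow> x \<notin> {1<..<2} \<Longrightarrow> u K t x = 0"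
  unfolding admissible_def by (blast intro: osc_eq_0)

lemma continuous_on_osc: "osc r u \<Longrightarrow> continuous_on S (u K t)"
  by (intro continuous_at_imp_continuous_on ballI isCont_osc)

lemma osc_L2: "osc r u \<Longrightarrow> admissible K t \<Longrightarrow> u K t \<in> L2 (dom_of c)"
  by (intro L2_supported continuous_on_osc osc_eq_0_admissible) auto

text \<open>\<open>v\<close> is the family \<open>T^p u\<close>. It is chosen before
  \<open>K\<close> and \<open>t\<close>, so that \<open>osc_bounded\<close> supplies a single
  constant for all frequencies and shifts.\<close>

lemma osc_sl_power:
  assumes "osc r u"
  shows "\<exists>v. osc (r + 2 * p) v \<and> (\<forall>K t. admissible K t \<longrightarrow>
    (\<forall>j. basis_coeff c j (v K t) = (2 * real j + 1) ^ p * basis_coeff c j (u K t)))"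
proof (induction p)
  case 0
  show ?case using assms by (intro exI[of _ u]) simp
next
  case (Suc p)
  then obtain v where v: "osc (r + 2 * p) v"
    "\<And>K t j. admissible K t \<Longrightarrow> basis_coeff c j (v K t) = (2 * real j + 1) ^ p * basis_coeff c j (u K t)"
    by blast
  obtain v' w where w: "osc (Suc (r + 2 * p)) v'" "osc (r + 2 * p + 2) w"
    "\<And>K t x. (v K t has_real_derivative v' K t x) (at x)"
    "\<And>K t x. ((\<lambda>x. sl_P c x * v' K t x) has_real_derivative (sl_Q c x * v K t x - w K t x)) (at x)"
    using osc_sl_operator[OF v(1), of c] by blast
  have "basis_coeff c j (w K t) = (2 * real j + 1) * basis_coeff c j (v K t)" if "admissible K t" for K t j
    by (rule greens_identity[of "v K t" "v' K t"])
       (auto intro!: w(3,4) continuous_on_osc[OF w(2)] osc_eq_0_admissible[OF w(1) that]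
          osc_eq_0_admissible[OF w(2) that] osc_eq_0_admissible[OF v(1) that])
  thus ?case using v(2) w(2) by (intro exI[of _ w]) (simp add: add.assoc)
qed

text \<open>Shifts at distance at least 1 have disjoint windows, so at each \<open>x\<close> at most
  one summand is nonzero and the bound does not grow with the size of \<open>I\<close>.\<close>

lemma sum_osc_bounded:
  assumes "osc r u" "finite I" "\<And>i i'. i \<in> I \<Longrightarrow> i' \<in> I \<Longrightarrow> i \<noteq> i' \<Longrightarrow> \<bar>t i - t i'\<bar> \<ge> (1::real)"
    and "\<And>i. i \<in> I \<Longrightarrow> \<bar>u K (t i) x\<bar> \<le> B" "0 \<le> B"
  shows "\<bar>\<Sum>i\<in>I. u K (t i) x\<bar> \<le> B"
proof (cases "\<exists>i\<in>I. u K (t i) x \<noteq> 0")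
  case True
  then obtain i where i: "i \<in> I" "u K (t i) x \<noteq> 0" by blast
  have "u K (t i') x = 0" if "i' \<in> I - {i}" for i'
  proof (rule ccontr)
    assume "u K (t i') x \<noteq> 0"
    hence "K * x - t i' \<in> {1<..<2}" "K * x - t i \<in> {1<..<2}"
      using osc_eq_0[OF assms(1)] i(2) by blast+
    thus False using assms(3)[of i i'] i that by auto
  qed
  hence "(\<Sum>i\<in>I. u K (t i) x) = u K (t i) x"
    using i(1) assms(2) by (subst sum.remove[of _ i]) auto
  thus ?thesis using assms(4) i by simp
qed (use assms in auto)

text \<open>Handles a fractional exponent: the constant 1 covers \<open>y \<le> 1\<close>, the
  integer power covers \<open>y > 1\<close>.\<close>

lemma powr_le_one_plus_power:
  fixes y :: real
  assumes "0 < y" "0 < s" "s \<le> real q"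
  shows "y powr s \<le> 1 + y ^ q"
proof (cases "y \<le> 1")
  case True
  hence "y powr s \<le> 1 powr s" using assms by (intro powr_mono2) auto
  thus ?thesis using assms(1) by (simp add: add_increasing2)
next
  case False
  hence "y powr s \<le> y powr real q" using assms by (intro powr_mono) auto
  thus ?thesis using assms(1) by (simp add: powr_realpow)
qed

lemma osc_sobolev_bound:
  assumes u: "osc 0 u" and s: "s > 0"
  obtains B where "B \<ge> 0"
    and "\<And>K (I :: nat set) t N. K \<ge> 1 \<Longrightarrow> finite I \<Longrightarrow> (\<And>i. i \<in> I \<Longrightarrow> admissible K (t i)) \<Longrightarrow>
      (\<And>i i'. i \<in> I \<Longrightarrow> i' \<in> I \<Longrightarrow> i \<noteq> i' \<Longrightarrow> \<bar>t i - t i'\<bar> \<ge> 1) \<Longrightarrow>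
      (\<Sum>j<N. real j powr s * (basis_coeff c j (\<lambda>x. \<Sum>i\<in>I. u K (t i) x))\<^sup>2) \<le> B * K powr (2 * s)"
proof -
  define p where "p = nat \<lceil>s\<rceil>"
  have p: "s \<le> real (2 * p)" using s unfolding p_def by linarith
  obtain v where v: "osc (2 * p) v"
    "\<And>K t j. admissible K t \<Longrightarrow> basis_coeff c j (v K t) = (2 * real j + 1) ^ p * basis_coeff c j (u K t)"
    using osc_sl_power[OF u, of p c] by auto
  obtain C D where C: "C \<ge> 0" "\<And>K t x. K \<ge> 1 \<Longrightarrow> x \<in> {1..2} \<Longrightarrow> \<bar>u K t x\<bar> \<le> C"
    and D: "D \<ge> 0" "\<And>K t x. K \<ge> 1 \<Longrightarrow> x \<in> {1..2} \<Longrightarrow> \<bar>v K t x\<bar> \<le> D * K ^ (2 * p)"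
    using osc_bounded[OF u] osc_bounded[OF v(1)] by auto
  show ?thesis
  proof (rule that[of "C\<^sup>2 + D\<^sup>2"])
    fix K :: real and I :: "nat set" and t :: "nat \<Rightarrow> real" and N :: nat
    assume K: "1 \<le> K" and fin: "finite I" and adm: "\<And>i. i \<in> I \<Longrightarrow> admissible K (t i)"
      and sep: "\<And>i i'. i \<in> I \<Longrightarrow> i' \<in> I \<Longrightarrow> i \<noteq> i' \<Longrightarrow> \<bar>t i - t i'\<bar> \<ge> 1"
    define G where "G = (\<lambda>x. \<Sum>i\<in>I. u K (t i) x)"
    define V where "V = (\<lambda>x. \<Sum>i\<in>I. v K (t i) x)"
    have L2: "G \<in> L2 (dom_of c)" "V \<in> L2 (dom_of c)"
      unfolding G_def V_def using adm by (auto intro!: L2_sum osc_L2[OF u] osc_L2[OF v(1)])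
    have coeff: "basis_coeff c j V = (2 * real j + 1) ^ p * basis_coeff c j G" for j
      unfolding basis_coeff_def G_def V_def
      by (subst (1 2) L2_inner_sum_left)
         (use adm v(2) in \<open>auto intro!: osc_L2[OF u] osc_L2[OF v(1)] basis_in_L2
            simp: sum_distrib_left basis_coeff_def\<close>)
    have G: "L2_inner (dom_of c) G G \<le> C\<^sup>2"
      using K adm sep C fin unfolding G_def
      by (intro L2_inner_self_supported_le sum_osc_bounded[OF u] sum.neutral
           continuous_on_sum continuous_on_osc[OF u]) (auto intro: osc_eq_0_admissible[OF u])
    have V: "L2_inner (dom_of c) V V \<le> (D * K ^ (2 * p))\<^sup>2"
      using K adm sep D fin unfolding V_def
      by (intro L2_inner_self_supported_le sum_osc_bounded[OF v(1)] sum.neutral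
           continuous_on_sum continuous_on_osc[OF v(1)]) (auto intro: osc_eq_0_admissible[OF v(1)])
    have bessel: "(\<Sum>j<N. (basis_coeff c j w)\<^sup>2) \<le> L2_inner (dom_of c) w w" if "w \<in> L2 (dom_of c)" for w
      using bessel_inequality[OF that, of "{..<N}" "basis_of c" 1]
      by (simp add: basis_in_L2 basis_orthonormal basis_coeff_def)
    have pointwise: "real j powr s * (basis_coeff c j G)\<^sup>2 \<le>
        K powr (2 * s) * ((basis_coeff c j G)\<^sup>2 + (basis_coeff c j V)\<^sup>2 / (K ^ (2 * p))\<^sup>2)" for j
    proof -
      \<comment> \<open>\<open>y\<close> measures the eigenvalue in units of \<open>K^2\<close>, its
        natural size at frequency \<open>K\<close>. The factor \<open>y ^ (2 * p)\<close> turns the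
        squared coefficient of \<open>G\<close> into that of \<open>V\<close>, divided by
        \<open>K^(4p)\<close>.\<close>
      define y where "y = (2 * real j + 1) / K\<^sup>2"
      have y: "y > 0" using K by (simp add: y_def)
      have "real j powr s \<le> (y * K\<^sup>2) powr s"
        using s K by (intro powr_mono2) (auto simp: y_def)
      also have "\<dots> = y powr s * K powr (2 * s)"
      proof -
        have "(K\<^sup>2) powr s = (K powr 2) powr s"
          using K by (simp add: powr_numeral)
        also have "\<dots> = K powr (2 * s)" by (rule powr_powr)
        finally show ?thesis using y by (simp add: powr_mult)
      qed
      also have "\<dots> \<le> (1 + y ^ (2 * p)) * K powr (2 * s)"
        using y s p by (intro mult_right_mono powr_le_one_plus_power) auto
      finally have "real j powr s * (basis_coeff c j G)\<^sup>2 \<le>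
          (1 + y ^ (2 * p)) * K powr (2 * s) * (basis_coeff c j G)\<^sup>2"
        by (intro mult_right_mono) auto
      also have "\<dots> = K powr (2 * s) * ((basis_coeff c j G)\<^sup>2 + (basis_coeff c j V)\<^sup>2 / (K ^ (2 * p))\<^sup>2)"
        by (simp add: coeff y_def algebra_simps power_divide power_mult_distrib flip: power_mult)
      finally show ?thesis .
    qed
    have "(\<Sum>j<N. real j powr s * (basis_coeff c j G)\<^sup>2) \<le>
       (\<Sum>j<N. K powr (2 * s) * ((basis_coeff c j G)\<^sup>2 + (basis_coeff c j V)\<^sup>2 / (K ^ (2 * p))\<^sup>2))"
      by (intro sum_mono pointwise)
    also have "\<dots> = K powr (2 * s) * ((\<Sum>j<N. (basis_coeff c j G)\<^sup>2) + (\<Sum>j<N. (basis_coeff c j V)\<^sup>2) / (K ^ (2 * p))\<^sup>2)"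
      by (simp add: sum_distrib_left sum.distrib sum_divide_distrib distrib_left)
    also have "\<dots> \<le> K powr (2 * s) * (C\<^sup>2 + (D * K ^ (2 * p))\<^sup>2 / (K ^ (2 * p))\<^sup>2)"
      using order.trans[OF bessel[OF L2(1)] G] order.trans[OF bessel[OF L2(2)] V]
      by (intro mult_left_mono add_mono divide_right_mono) auto
    also have "\<dots> = (C\<^sup>2 + D\<^sup>2) * K powr (2 * s)"
      using K by (simp add: power_mult_distrib)
    finally show "(\<Sum>j<N. real j powr s * (basis_coeff c j (\<lambda>x. \<Sum>i\<in>I. u K (t i) x))\<^sup>2) \<le> (C\<^sup>2 + D\<^sup>2) * K powr (2 * s)"
      unfolding G_def .
  qed simp
qed

section \<open>Assouad's lemma\<close>

text \<open>Change of measure: all sampling laws indexed by switch patterns can then be compared on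
  one reference product space.\<close>

lemma PiM_density:
  fixes h :: "'a \<Rightarrow> real"
  assumes "prob_space \<mu>" and h[measurable]: "h \<in> borel_measurable \<mu>" and nn: "\<And>x. x \<in> space \<mu> \<Longrightarrow> 0 \<le> h x"
    and "prob_space (density \<mu> (\<lambda>x. ennreal (h x)))" and "finite I"
  shows "PiM I (\<lambda>_. density \<mu> (\<lambda>x. ennreal (h x))) =
    density (PiM I (\<lambda>_. \<mu>)) (\<lambda>X. ennreal (\<Prod>i\<in>I. h (X i)))"
proof -
  interpret M: prob_space \<mu> by fact
  interpret D: prob_space "density \<mu> (\<lambda>x. ennreal (h x))" by fact
  interpret PM: product_sigma_finite "\<lambda>_::'b. \<mu>" by standard
  interpret PD: product_sigma_finite "\<lambda>_::'b. density \<mu> (\<lambda>x. ennreal (h x))" by standard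
  show ?thesis
  proof (rule PD.PiM_eqI[symmetric])
    show "sets (density (PiM I (\<lambda>_. \<mu>)) (\<lambda>X. ennreal (\<Prod>i\<in>I. h (X i)))) =
        sets (PiM I (\<lambda>_. density \<mu> (\<lambda>x. ennreal (h x))))"
      by (simp cong: sets_PiM_cong)
    fix A assume A': "\<And>i. i \<in> I \<Longrightarrow> A i \<in> sets (density \<mu> (\<lambda>x. ennreal (h x)))"
    hence A: "\<And>i. i \<in> I \<Longrightarrow> A i \<in> sets \<mu>" by simp
    have "emeasure (density (PiM I (\<lambda>_. \<mu>)) (\<lambda>X. ennreal (\<Prod>i\<in>I. h (X i)))) (Pi\<^sub>E I A) =
      (\<integral>\<^sup>+X. ennreal (\<Prod>i\<in>I. h (X i)) * indicator (Pi\<^sub>E I A) X \<partial>PiM I (\<lambda>_. \<mu>))"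
      using A \<open>finite I\<close> by (intro emeasure_density) (auto intro!: sets_PiM_I_finite)
    also have "\<dots> = (\<integral>\<^sup>+X. (\<Prod>i\<in>I. ennreal (h (X i)) * indicator (A i) (X i)) \<partial>PiM I (\<lambda>_. \<mu>))"
    proof (rule nn_integral_cong)
      fix X assume X: "X \<in> space (PiM I (\<lambda>_. \<mu>))"
      have "indicator (Pi\<^sub>E I A) X = (\<Prod>i\<in>I. indicator (A i) (X i) :: ennreal)"
      proof (cases "\<forall>i\<in>I. X i \<in> A i")
        case True
        thus ?thesis using X by (auto simp: space_PiM PiE_iff)
      next
        case False
        hence "X \<notin> Pi\<^sub>E I A" by auto
        moreover have "(\<Prod>i\<in>I. indicator (A i) (X i) :: ennreal) = 0"
          using False \<open>finite I\<close> by (intro prod_zero) (auto simp: indicator_def)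
        ultimately show ?thesis by simp
      qed
      moreover have "ennreal (\<Prod>i\<in>I. h (X i)) = (\<Prod>i\<in>I. ennreal (h (X i)))"
        using X nn by (intro prod_ennreal[symmetric]) (auto simp: space_PiM)
      ultimately show "ennreal (\<Prod>i\<in>I. h (X i)) * indicator (Pi\<^sub>E I A) X =
          (\<Prod>i\<in>I. ennreal (h (X i)) * indicator (A i) (X i))"
        by (simp add: prod.distrib)
    qed
    also have "\<dots> = (\<Prod>i\<in>I. \<integral>\<^sup>+x. ennreal (h x) * indicator (A i) x \<partial>\<mu>)"
      using A \<open>finite I\<close> by (intro PM.product_nn_integral_prod) auto
    also have "\<dots> = (\<Prod>i\<in>I. emeasure (density \<mu> (\<lambda>x. ennreal (h x))) (A i))"
      using A by (intro prod.cong refl emeasure_density[symmetric]) auto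
    finally show "emeasure (density (PiM I (\<lambda>_. \<mu>)) (\<lambda>X. ennreal (\<Prod>i\<in>I. h (X i)))) (Pi\<^sub>E I A) =
      (\<Prod>i\<in>I. emeasure (density \<mu> (\<lambda>x. ennreal (h x))) (A i))" .
  qed fact
qed

text \<open>The left side is at most \<open>exp (1 / 2)\<close>, whose square is at most 3.\<close>

lemma power_one_plus_inverse_le_2:
  assumes "n > 0" shows "(1 + 1 / (2 * real n)) ^ n \<le> (2::real)"
proof -
  have "(1 + 1 / (2 * real n)) ^ n \<le> exp (1 / (2 * real n)) ^ n"
    by (intro power_mono exp_ge_add_one_self) auto
  also have "\<dots> = exp (1 / 2 :: real)" using assms by (simp flip: exp_of_nat_mult)
  also have "\<dots> \<le> 2"
  proof (rule power2_le_imp_le)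
    show "(exp (1 / 2 :: real))\<^sup>2 \<le> 2\<^sup>2"
      using exp_le by (simp flip: exp_double)
  qed simp
  finally show ?thesis .
qed

text \<open>Bounding the harmonic mean of two likelihoods below by \<open>(3 q - q\<^sup>2 / p) / 4\<close> reduces the
  separation of the product measures to a chi-square divergence, which tensorizes.\<close>

lemma harmonic_mean_ge:
  fixes p q :: real assumes "p > 0" "q > 0"
  shows "(3 * q - q\<^sup>2 / p) / 4 \<le> p * q / (p + q)"
proof -
  have "0 \<le> q * (p - q)\<^sup>2" using assms by simp
  hence "(3 * q * p - q\<^sup>2) * (p + q) \<le> 4 * p * q * p"
    by (simp add: algebra_simps power2_eq_square)
  thus ?thesis using assms by (simp add: field_simps power2_eq_square)
qed

text \<open>Since \<open>g^2 / f = (g - f)^2 / f + (2 g - f)\<close> and \<open>f \<ge> 1/2\<close>,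
  one observation gives an integral of \<open>g^2 / f\<close> of at most
  \<open>1 + 1 / (2 n)\<close>. The product measure raises it to the power \<open>n\<close>, which
  stays below 2, and the lower bound for the harmonic mean integrates to at least
  \<open>(3 - 2) / 4\<close>.\<close>

lemma likelihood_overlap:
  fixes f g :: "'a \<Rightarrow> real"
  assumes "prob_space \<mu>" "n > 0"
    and [measurable]: "f \<in> borel_measurable \<mu>" "g \<in> borel_measurable \<mu>"
    and f: "\<And>x. x \<in> space \<mu> \<Longrightarrow> f x \<in> {1/2..3/2}" and g: "\<And>x. x \<in> space \<mu> \<Longrightarrow> g x \<in> {1/2..3/2}"
    and int: "(LINT x|\<mu>. f x) = 1" "(LINT x|\<mu>. g x) = 1"
    and chi: "(LINT x|\<mu>. (g x - f x)\<^sup>2) \<le> 1 / (4 * real n)"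
  shows "ennreal (1/4) \<le> (\<integral>\<^sup>+X. ennreal ((\<Prod>i<n. f (X i)) * (\<Prod>i<n. g (X i)) /
    ((\<Prod>i<n. f (X i)) + (\<Prod>i<n. g (X i)))) \<partial>PiM {..<n} (\<lambda>_. \<mu>))"
proof -
  interpret M: prob_space \<mu> by fact
  interpret PM: product_sigma_finite "\<lambda>_::nat. \<mu>" by standard
  let ?N = "PiM {..<n} (\<lambda>_. \<mu>)"
  define p q where "p X = (\<Prod>i<n. f (X i))" and "q X = (\<Prod>i<n. g (X i))" for X :: "nat \<Rightarrow> 'a"
  have pos: "p X > 0" "q X > 0" if "X \<in> space ?N" for X
  proof -
    have "f (X i) > 0" "g (X i) > 0" if "i < n" for i
    proof -
      have "X i \<in> space \<mu>" using \<open>X \<in> space ?N\<close> that by (simp add: space_PiM PiE_iff)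
      from f[OF this] g[OF this] show "f (X i) > 0" "g (X i) > 0" by auto
    qed
    thus "p X > 0" "q X > 0" unfolding p_def q_def by (auto intro: prod_pos)
  qed
  have bdd: "integrable \<mu> w" if "w \<in> borel_measurable \<mu>" "\<And>x. x \<in> space \<mu> \<Longrightarrow> \<bar>w x\<bar> \<le> B" for w and B :: real
    using that by (intro M.integrable_const_bound[of _ B]) auto
  have abs: "\<bar>f x\<bar> \<le> 3/2" "\<bar>g x\<bar> \<le> 3/2" if "x \<in> space \<mu>" for x
    using f[OF that] g[OF that] by (auto simp: abs_le_iff)
  have "integrable \<mu> g" by (rule bdd[OF assms(4) abs(2)])
  moreover have "integrable \<mu> f" by (rule bdd[OF assms(3) abs(1)])
  ultimately have ig: "integrable \<mu> g" "integrable \<mu> f" by blast+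
  have sq: "(g x - f x)\<^sup>2 \<le> 1" if "x \<in> space \<mu>" for x
    using f[OF that] g[OF that] by (subst abs_square_le_1) auto
  have isq: "integrable \<mu> (\<lambda>x. (g x - f x)\<^sup>2)"
    using sq by (intro bdd[of _ 1]) auto
  have idiv: "integrable \<mu> (\<lambda>x. (g x - f x)\<^sup>2 / f x)"
  proof (rule bdd[of _ 2])
    fix x assume x: "x \<in> space \<mu>"
    have "(g x - f x)\<^sup>2 / f x \<le> 1 / (1/2)"
      using sq[OF x] f[OF x] by (intro frac_le) auto
    thus "\<bar>(g x - f x)\<^sup>2 / f x\<bar> \<le> 2" using f[OF x] by simp
  qed simp
  have expand: "(g x)\<^sup>2 / f x = (g x - f x)\<^sup>2 / f x + (2 * g x - f x)" if "x \<in> space \<mu>" for x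
    using f[OF that] by (simp add: field_simps power2_eq_square)
  have igf: "integrable \<mu> (\<lambda>x. (g x)\<^sup>2 / f x)"
    by (subst Bochner_Integration.integrable_cong[OF refl expand]) (use idiv ig in auto)
  have "(LINT x|\<mu>. (g x)\<^sup>2 / f x) = (LINT x|\<mu>. (g x - f x)\<^sup>2 / f x + (2 * g x - f x))"
    by (intro Bochner_Integration.integral_cong refl expand)
  also have "\<dots> = (LINT x|\<mu>. (g x - f x)\<^sup>2 / f x) + 1"
    using idiv ig int by simp
  also have "(LINT x|\<mu>. (g x - f x)\<^sup>2 / f x) \<le> (LINT x|\<mu>. 2 * (g x - f x)\<^sup>2)"
  proof (rule integral_mono[OF idiv])
    fix x assume x: "x \<in> space \<mu>"
    have "(g x - f x)\<^sup>2 / f x \<le> (g x - f x)\<^sup>2 / (1/2)"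
      using f[OF x] by (intro divide_left_mono) auto
    thus "(g x - f x)\<^sup>2 / f x \<le> 2 * (g x - f x)\<^sup>2" by simp
  qed (use isq in simp)
  also have "(LINT x|\<mu>. 2 * (g x - f x)\<^sup>2) = 2 * (LINT x|\<mu>. (g x - f x)\<^sup>2)" by simp
  finally have one_obs: "(LINT x|\<mu>. (g x)\<^sup>2 / f x) \<le> 1 + 1 / (2 * real n)"
    using chi by (simp add: field_simps)
  have iq: "integrable ?N q"
    unfolding q_def using ig by (intro PM.product_integrable_prod) auto
  have Eq: "(LINT X|?N. q X) = 1"
    unfolding q_def using ig int PM.product_integral_prod[of "{..<n}" "\<lambda>_. g"] by simp
  have ratio: "(q X)\<^sup>2 / p X = (\<Prod>i<n. (g (X i))\<^sup>2 / f (X i))" for X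
    by (simp add: p_def q_def prod_dividef prod_power_distrib)
  have iqp: "integrable ?N (\<lambda>X. (q X)\<^sup>2 / p X)"
    unfolding ratio using igf by (intro PM.product_integrable_prod) auto
  have "(LINT X|?N. (q X)\<^sup>2 / p X) = (LINT x|\<mu>. (g x)\<^sup>2 / f x) ^ n"
    unfolding ratio using igf by (subst PM.product_integral_prod) auto
  also have "\<dots> \<le> (1 + 1 / (2 * real n)) ^ n"
    using f by (intro power_mono one_obs integral_nonneg_AE AE_I2 divide_nonneg_pos) fastforce+
  also have "\<dots> \<le> 2" by (rule power_one_plus_inverse_le_2) fact
  finally have Eqp: "(LINT X|?N. (q X)\<^sup>2 / p X) \<le> 2" .
  have [measurable]: "p \<in> borel_measurable ?N" "q \<in> borel_measurable ?N"
    unfolding p_def q_def by measurable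
  have ih: "integrable ?N (\<lambda>X. p X * q X / (p X + q X))"
  proof (rule Bochner_Integration.integrable_bound[OF iq])
    show "AE X in ?N. norm (p X * q X / (p X + q X)) \<le> norm (q X)"
    proof (rule AE_I2)
      fix X assume X: "X \<in> space ?N"
      have "p X * q X / (p X + q X) \<le> q X"
        using pos[OF X] by (simp add: field_simps)
      thus "norm (p X * q X / (p X + q X)) \<le> norm (q X)"
        using pos[OF X] by simp
    qed
  qed measurable
  have "1 / 4 \<le> (LINT X|?N. (3 * q X - (q X)\<^sup>2 / p X) / 4)"
    using iq iqp Eq Eqp by simp
  also have "\<dots> \<le> (LINT X|?N. p X * q X / (p X + q X))"
    using iq iqp pos by (intro integral_mono ih harmonic_mean_ge) auto
  finally have "ennreal (1 / 4) \<le> ennreal (LINT X|?N. p X * q X / (p X + q X))"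
    by (rule ennreal_leI)
  also have "\<dots> = (\<integral>\<^sup>+X. ennreal (p X * q X / (p X + q X)) \<partial>?N)"
    using pos by (intro nn_integral_eq_integral[symmetric] ih AE_I2) (simp add: less_imp_le)
  finally show ?thesis unfolding p_def q_def .
qed

lemma sum_Pow_pair:
  assumes "finite A" "k \<in> A"
  shows "(\<Sum>S\<in>Pow A. F S) = (\<Sum>S\<in>Pow (A - {k}). F S + F (insert k S) :: 'b :: comm_monoid_add)"
proof -
  have "Pow A = Pow (A - {k}) \<union> insert k ` Pow (A - {k})"
    using Pow_insert[of k "A - {k}"] assms by (simp add: insert_absorb)
  moreover have "inj_on (insert k) (Pow (A - {k}))"
    by (intro inj_onI) (auto simp: insert_eq_iff)
  ultimately show ?thesis
    using assms by (simp only:) (subst sum.union_disjoint, auto simp: sum.reindex sum.distrib)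
qed

text \<open>The right side is minimal at \<open>a = q d / (p + q)\<close>, with equality there. No
  real guess \<open>a\<close> can be close to both 0 and \<open>d\<close> while both likelihoods are
  substantial.\<close>

lemma weighted_two_point:
  fixes p q a d :: real
  assumes "p > 0" "q > 0"
  shows "d\<^sup>2 * (p * q / (p + q)) \<le> p * a\<^sup>2 + q * (a - d)\<^sup>2"
proof -
  have "0 \<le> ((p + q) * a - q * d)\<^sup>2" by simp
  hence "d\<^sup>2 * (p * q) \<le> (p * a\<^sup>2 + q * (a - d)\<^sup>2) * (p + q)"
    by (simp add: algebra_simps power2_eq_square)
  thus ?thesis using assms by (simp add: pos_divide_le_eq)
qed

text \<open>\<open>loss\<close> has to dominate the squared distance from a point \<open>a\<close>,
  which may depend on \<open>X\<close> but not on \<open>S\<close>, to the cube vertex encoded by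
  \<open>S\<close>. For each \<open>k\<close> the patterns pair up as \<open>S\<close> and
  \<open>insert k S\<close>; each of the \<open>2 ^ (K - 1)\<close> pairs contributes at least
  \<open>d^2 / 4\<close>, and summing over \<open>k\<close> gives the constant.\<close>

lemma assouad:
  fixes h :: "nat set \<Rightarrow> 'a \<Rightarrow> real" and loss :: "nat set \<Rightarrow> (nat \<Rightarrow> 'a) \<Rightarrow> real"
  assumes \<mu>: "prob_space \<mu>" and n: "n > 0"
    and h[measurable]: "\<And>S. S \<subseteq> {..<K} \<Longrightarrow> h S \<in> borel_measurable \<mu>"
    and range: "\<And>S x. S \<subseteq> {..<K} \<Longrightarrow> x \<in> space \<mu> \<Longrightarrow> h S x \<in> {1/2..3/2}"
    and int: "\<And>S. S \<subseteq> {..<K} \<Longrightarrow> (LINT x|\<mu>. h S x) = 1"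
    and chi: "\<And>S k. S \<subseteq> {..<K} \<Longrightarrow> k < K \<Longrightarrow> k \<notin> S \<Longrightarrow>
        (LINT x|\<mu>. (h (insert k S) x - h S x)\<^sup>2) \<le> 1 / (4 * real n)"
    and loss[measurable]: "\<And>S. S \<subseteq> {..<K} \<Longrightarrow> loss S \<in> borel_measurable (PiM {..<n} (\<lambda>_. \<mu>))"
    and sep: "\<And>X. X \<in> space (PiM {..<n} (\<lambda>_. \<mu>)) \<Longrightarrow>
        \<exists>a. \<forall>S\<subseteq>{..<K}. (\<Sum>k<K. (a k - (if k \<in> S then d else 0))\<^sup>2) \<le> loss S X"
  shows "ennreal (2 ^ K * (real K * d\<^sup>2 / 8)) \<le>
    (\<Sum>S\<in>Pow {..<K}. \<integral>\<^sup>+X. ennreal (loss S X) \<partial>PiM {..<n} (\<lambda>_. density \<mu> (\<lambda>x. ennreal (h S x))))"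
proof -
  interpret M: prob_space \<mu> by fact
  let ?N = "PiM {..<n} (\<lambda>_. \<mu>)"
  define p where "p S X = (\<Prod>i<n. h S (X i))" for S and X :: "nat \<Rightarrow> 'a"
  define R where "R k S X = p S X * p (insert k S) X / (p S X + p (insert k S) X)" for k S and X :: "nat \<Rightarrow> 'a"
  have pos: "p S X > 0" if "S \<subseteq> {..<K}" "X \<in> space ?N" for S X
  proof -
    have "h S (X i) > 0" if "i < n" for i
    proof -
      have "X i \<in> space \<mu>" using \<open>X \<in> space ?N\<close> that by (simp add: space_PiM PiE_iff)
      from range[OF \<open>S \<subseteq> {..<K}\<close> this] show ?thesis by simp
    qed
    thus ?thesis unfolding p_def by (auto intro: prod_pos)
  qed
  have p_meas[measurable]: "p S \<in> borel_measurable ?N" if "S \<subseteq> {..<K}" for S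
    using h[OF that] unfolding p_def by measurable
  have ins: "insert k S \<subseteq> {..<K}" "S \<subseteq> {..<K}" "k \<notin> S" if "k < K" "S \<in> Pow ({..<K} - {k})" for k S
    using that by auto
  have R_meas: "R k S \<in> borel_measurable ?N" if "k < K" "S \<in> Pow ({..<K} - {k})" for k S
    unfolding R_def using p_meas[OF ins(1)[OF that]] p_meas[OF ins(2)[OF that]] by measurable
  have R_nonneg: "0 \<le> R k S X" if "k < K" "S \<in> Pow ({..<K} - {k})" "X \<in> space ?N" for k S X
    unfolding R_def using pos[OF ins(1)[OF that(1,2)] that(3)] pos[OF ins(2)[OF that(1,2)] that(3)] by simp
  have R_int: "ennreal (1/4) \<le> (\<integral>\<^sup>+X. ennreal (R k S X) \<partial>?N)" if "k < K" "S \<in> Pow ({..<K} - {k})" for k S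
    unfolding R_def p_def using ins[OF that] that(1)
    by (intro likelihood_overlap \<mu> n h range int chi) auto
  have change: "(\<integral>\<^sup>+X. ennreal (loss S X) \<partial>PiM {..<n} (\<lambda>_. density \<mu> (\<lambda>x. ennreal (h S x)))) =
      (\<integral>\<^sup>+X. ennreal (p S X * loss S X) \<partial>?N)" if S: "S \<subseteq> {..<K}" for S
  proof -
    have hS: "integrable \<mu> (h S)"
      using range[OF S] h[OF S] by (intro M.integrable_const_bound[of _ "3/2"]) fastforce+
    have nn: "0 \<le> h S x" if "x \<in> space \<mu>" for x
      using range[OF S that] by simp
    have "emeasure (density \<mu> (\<lambda>x. ennreal (h S x))) (space \<mu>) = (\<integral>\<^sup>+x. ennreal (h S x) \<partial>\<mu>)"
      using h[OF S] by (simp add: emeasure_density cong: nn_integral_cong)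
    also have "\<dots> = 1"
      using int[OF S] nn by (subst nn_integral_eq_integral[OF hS]) auto
    finally have "prob_space (density \<mu> (\<lambda>x. ennreal (h S x)))"
      by (intro prob_spaceI) simp
    hence "PiM {..<n} (\<lambda>_. density \<mu> (\<lambda>x. ennreal (h S x))) = density ?N (\<lambda>X. ennreal (p S X))"
      unfolding p_def by (intro PiM_density \<mu> h[OF S] nn) auto
    hence "(\<integral>\<^sup>+X. ennreal (loss S X) \<partial>PiM {..<n} (\<lambda>_. density \<mu> (\<lambda>x. ennreal (h S x)))) =
        (\<integral>\<^sup>+X. ennreal (p S X) * ennreal (loss S X) \<partial>?N)"
      using p_meas[OF S] loss[OF S] by (simp add: nn_integral_density)
    also have "\<dots> = (\<integral>\<^sup>+X. ennreal (p S X * loss S X) \<partial>?N)"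
      using pos[OF S] by (intro nn_integral_cong) (simp add: ennreal_mult' less_imp_le)
    finally show ?thesis .
  qed
  have pointwise: "(\<Sum>k<K. \<Sum>S\<in>Pow ({..<K} - {k}). d\<^sup>2 * R k S X) \<le> (\<Sum>S\<in>Pow {..<K}. p S X * loss S X)"
    if X: "X \<in> space ?N" for X
  proof -
    obtain a where a: "\<And>S. S \<subseteq> {..<K} \<Longrightarrow> (\<Sum>k<K. (a k - (if k \<in> S then d else 0))\<^sup>2) \<le> loss S X"
      using sep[OF X] by blast
    have "(\<Sum>k<K. \<Sum>S\<in>Pow ({..<K} - {k}). d\<^sup>2 * R k S X) \<le>
       (\<Sum>k<K. \<Sum>S\<in>Pow ({..<K} - {k}). p S X * (a k)\<^sup>2 + p (insert k S) X * (a k - d)\<^sup>2)"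
      unfolding R_def using ins X by (intro sum_mono weighted_two_point pos) blast+
    also have "\<dots> = (\<Sum>k<K. \<Sum>S\<in>Pow {..<K}. p S X * (a k - (if k \<in> S then d else 0))\<^sup>2)"
    proof (rule sum.cong[OF refl])
      fix k assume "k \<in> {..<K}"
      thus "(\<Sum>S\<in>Pow ({..<K} - {k}). p S X * (a k)\<^sup>2 + p (insert k S) X * (a k - d)\<^sup>2) =
          (\<Sum>S\<in>Pow {..<K}. p S X * (a k - (if k \<in> S then d else 0))\<^sup>2)"
        by (subst sum_Pow_pair[of "{..<K}" k]) (auto intro!: sum.cong)
    qed
    also have "\<dots> = (\<Sum>S\<in>Pow {..<K}. p S X * (\<Sum>k<K. (a k - (if k \<in> S then d else 0))\<^sup>2))"
      by (subst sum.swap) (simp add: sum_distrib_left)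
    also have "\<dots> \<le> (\<Sum>S\<in>Pow {..<K}. p S X * loss S X)"
      using pos[OF _ X] by (intro sum_mono mult_left_mono a) (auto simp: less_imp_le)
    finally show ?thesis .
  qed
  \<comment> \<open>Needed because \<open>ennreal\<close> truncates negative numbers to 0 and would
    then not commute with the sum over \<open>S\<close>.\<close>
  have loss_nonneg: "0 \<le> loss S X" if "S \<subseteq> {..<K}" "X \<in> space ?N" for S X
    using sep[OF that(2)] that(1) by (meson order_trans sum_nonneg zero_le_power2)
  have "ennreal (2 ^ K * (real K * d\<^sup>2 / 8)) = (\<Sum>k<K. \<Sum>S\<in>Pow ({..<K} - {k}). ennreal (d\<^sup>2) * ennreal (1/4))"
  proof (cases "K = 0")
    case False
    \<comment> \<open>There are \<open>2 ^ (K - 1)\<close> patterns avoiding \<open>k\<close>; with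
      truncated subtraction this rewriting requires \<open>K \<noteq> 0\<close>.\<close>
    have "(2::real) ^ K = 2 * 2 ^ (K - 1)" using False by (cases K) auto
    hence "ennreal (2 ^ K * (real K * d\<^sup>2 / 8)) = ennreal (\<Sum>k<K. \<Sum>S\<in>Pow ({..<K} - {k}). d\<^sup>2 * (1/4))"
      by (simp add: card_Pow)
    also have "\<dots> = (\<Sum>k<K. \<Sum>S\<in>Pow ({..<K} - {k}). ennreal (d\<^sup>2) * ennreal (1/4))"
    proof -
      have "(\<Sum>k<K. \<Sum>S\<in>Pow ({..<K} - {k}). ennreal (d\<^sup>2) * ennreal (1/4)) =
          (\<Sum>k<K. \<Sum>S\<in>Pow ({..<K} - {k}). ennreal (d\<^sup>2 * (1/4)))"
        by (intro sum.cong refl ennreal_mult[symmetric]) auto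
      also have "\<dots> = (\<Sum>k<K. ennreal (\<Sum>S\<in>Pow ({..<K} - {k}). d\<^sup>2 * (1/4)))"
        by (intro sum.cong[OF refl] sum_ennreal) auto
      also have "\<dots> = ennreal (\<Sum>k<K. \<Sum>S\<in>Pow ({..<K} - {k}). d\<^sup>2 * (1/4))"
        by (intro sum_ennreal sum_nonneg) auto
      finally show ?thesis by (rule sym)
    qed
    finally show ?thesis .
  qed simp
  also have "\<dots> \<le> (\<Sum>k<K. \<Sum>S\<in>Pow ({..<K} - {k}). ennreal (d\<^sup>2) * (\<integral>\<^sup>+X. ennreal (R k S X) \<partial>?N))"
    by (intro sum_mono mult_left_mono R_int) auto
  also have "\<dots> = (\<integral>\<^sup>+X. (\<Sum>k<K. \<Sum>S\<in>Pow ({..<K} - {k}). ennreal (d\<^sup>2) * ennreal (R k S X)) \<partial>?N)"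
  proof -
    have meas: "(\<lambda>X. ennreal (R k S X)) \<in> borel_measurable ?N" if "k < K" "S \<in> Pow ({..<K} - {k})" for k S
      using R_meas[OF that] by measurable
    have "(\<Sum>k<K. \<Sum>S\<in>Pow ({..<K} - {k}). ennreal (d\<^sup>2) * (\<integral>\<^sup>+X. ennreal (R k S X) \<partial>?N)) =
        (\<Sum>k<K. \<Sum>S\<in>Pow ({..<K} - {k}). \<integral>\<^sup>+X. ennreal (d\<^sup>2) * ennreal (R k S X) \<partial>?N)"
      by (intro sum.cong refl nn_integral_cmult[symmetric] meas) auto
    also have "\<dots> = (\<Sum>k<K. \<integral>\<^sup>+X. (\<Sum>S\<in>Pow ({..<K} - {k}). ennreal (d\<^sup>2) * ennreal (R k S X)) \<partial>?N)"
      by (intro sum.cong[OF refl] nn_integral_sum[symmetric] borel_measurable_times_ennreal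
           borel_measurable_const meas) auto
    also have "\<dots> = (\<integral>\<^sup>+X. (\<Sum>k<K. \<Sum>S\<in>Pow ({..<K} - {k}). ennreal (d\<^sup>2) * ennreal (R k S X)) \<partial>?N)"
      by (intro nn_integral_sum[symmetric] borel_measurable_sum borel_measurable_times_ennreal
           borel_measurable_const meas) auto
    finally show ?thesis .
  qed
  also have "\<dots> = (\<integral>\<^sup>+X. ennreal (\<Sum>k<K. \<Sum>S\<in>Pow ({..<K} - {k}). d\<^sup>2 * R k S X) \<partial>?N)"
  proof (rule nn_integral_cong)
    fix X assume X: "X \<in> space ?N"
    have "(\<Sum>k<K. \<Sum>S\<in>Pow ({..<K} - {k}). ennreal (d\<^sup>2) * ennreal (R k S X)) =
        (\<Sum>k<K. \<Sum>S\<in>Pow ({..<K} - {k}). ennreal (d\<^sup>2 * R k S X))"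
      by (intro sum.cong refl ennreal_mult'[symmetric]) simp
    also have "\<dots> = (\<Sum>k<K. ennreal (\<Sum>S\<in>Pow ({..<K} - {k}). d\<^sup>2 * R k S X))"
      using R_nonneg X by (intro sum.cong refl sum_ennreal) auto
    also have "\<dots> = ennreal (\<Sum>k<K. \<Sum>S\<in>Pow ({..<K} - {k}). d\<^sup>2 * R k S X)"
      using R_nonneg X by (intro sum_ennreal sum_nonneg) auto
    finally show "(\<Sum>k<K. \<Sum>S\<in>Pow ({..<K} - {k}). ennreal (d\<^sup>2) * ennreal (R k S X)) = \<dots>" .
  qed
  also have "\<dots> \<le> (\<integral>\<^sup>+X. ennreal (\<Sum>S\<in>Pow {..<K}. p S X * loss S X) \<partial>?N)"
    by (intro nn_integral_mono ennreal_leI pointwise)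
  also have "\<dots> = (\<integral>\<^sup>+X. (\<Sum>S\<in>Pow {..<K}. ennreal (p S X * loss S X)) \<partial>?N)"
    using pos loss_nonneg by (intro nn_integral_cong sum_ennreal[symmetric]) (auto simp: less_imp_le)
  also have "\<dots> = (\<Sum>S\<in>Pow {..<K}. \<integral>\<^sup>+X. ennreal (p S X * loss S X) \<partial>?N)"
    using p_meas loss by (intro nn_integral_sum) auto
  also have "\<dots> = (\<Sum>S\<in>Pow {..<K}. \<integral>\<^sup>+X. ennreal (loss S X) \<partial>PiM {..<n} (\<lambda>_. density \<mu> (\<lambda>x. ennreal (h S x))))"
    using change by (intro sum.cong) auto
  finally show ?thesis .
qed

section \<open>Perturbed densities\<close>

lemma integral_supported_pos:
  fixes w :: "real \<Rightarrow> real"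
  assumes "continuous_on {1..2} w" "\<And>x. x \<notin> {1..2} \<Longrightarrow> w x = 0" "\<And>x. 0 \<le> w x" "w x\<^sub>0 \<noteq> 0"
  shows "0 < (LINT x|lborel. w x)"
proof -
  have si: "set_integrable lborel {1..2} w"
    using borel_integrable_atLeastAtMost'[OF assms(1)] .
  have eq: "(\<lambda>x. indicator {1..2} x *\<^sub>R w x) = w"
    using assms(2) by (auto simp: indicator_def fun_eq_iff)
  have "(LINT x|lborel. w x) = integral ({1..2}) w"
    using set_borel_integral_eq_integral(2)[OF si] eq by (simp add: set_lebesgue_integral_def)
  moreover have "integral ({1..2}) w \<noteq> 0"
  proof
    assume "integral ({1..2}) w = 0"
    hence "\<forall>x\<in>{1..2}. w x = 0"
      using integral_eq_0_iff[of 1 2 w] assms(1,3) by simp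
    thus False using assms(2,4) by auto
  qed
  moreover have "0 \<le> (LINT x|lborel. w x)"
    using assms(3) by simp
  ultimately show ?thesis by linarith
qed

lemma deriv_bump_eq_0: "x \<notin> {1<..<2} \<Longrightarrow> deriv bump x = 0"
  using bump_deriv_eq_0[of x 1] by simp

lemma continuous_on_deriv_bump: "continuous_on S (deriv bump)"
  using continuous_on_bump_deriv[of S 1] by simp

lemma osc_deriv_bump: "osc r (\<lambda>K t x. deriv bump (K * x - t))"
  using osc_bump_deriv[of r 1] by simp

section \<open>Mass and energy of the bump, and rescaled integrals\<close>

lemma deriv_bump_nonzero: "\<exists>x. deriv bump x \<noteq> 0"
proof -
  have "\<exists>z. 1 < z \<and> z < 3/2 \<and> bump (3/2) - bump 1 = (3/2 - 1) * deriv bump z"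
    using bump_deriv_deriv[of 0] by (intro MVT2) auto
  moreover have "bump 1 = 0" "bump (3/2) > 0"
    using bump_deriv_eq_0[of 1 0] bump_pos[of "3/2"] by auto
  ultimately show ?thesis by (metis less_irrefl mult_zero_right diff_zero)
qed

definition bump_mass :: real where
  "bump_mass = (LINT x|lborel. bump x)"

definition bump_energy :: real where
  "bump_energy = (LINT x|lborel. (deriv bump x)\<^sup>2)"

lemma bump_mass_pos: "0 < bump_mass"
  unfolding bump_mass_def
  using continuous_on_bump_deriv[of _ 0] bump_deriv_eq_0[of _ 0] bump_nonneg bump_pos[of "3/2"]
  by (intro integral_supported_pos[of _ "3/2"]) auto

lemma bump_energy_pos: "0 < bump_energy"
proof -
  obtain x\<^sub>0 where "deriv bump x\<^sub>0 \<noteq> 0" using deriv_bump_nonzero by blast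
  thus ?thesis
    unfolding bump_energy_def
    by (intro integral_supported_pos[of _ x\<^sub>0] continuous_intros continuous_on_deriv_bump)
       (auto simp: deriv_bump_eq_0)
qed

text \<open>The reason for perturbing by \<open>deriv bump\<close> rather than by
  \<open>bump\<close>: perturbations without mass leave the total integral of the density equal to
  1.\<close>

lemma integral_deriv_bump: "(LINT x|lborel. deriv bump x) = 0"
proof -
  have "(LINT x|lborel. indicator {1..2} x *\<^sub>R deriv bump x) = bump 2 - bump 1"
  proof (rule integral_FTC_atLeastAtMost)
    show "(bump has_vector_derivative deriv bump x) (at x within {1..2})" for x
      using bump_deriv_deriv[of 0 x]
      by (simp add: has_field_derivative_at_within flip: has_real_derivative_iff_has_vector_derivative)
  qed (auto intro: continuous_on_deriv_bump)
  moreover have "(\<lambda>x. indicator {1..2} x *\<^sub>R deriv bump x) = deriv bump"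
  proof
    show "indicator {1..2} x *\<^sub>R deriv bump x = deriv bump x" for x
      using deriv_bump_eq_0[of x] by (cases "x \<in> {1<..<2}") (auto simp: indicator_def)
  qed
  ultimately show ?thesis using bump_deriv_eq_0[of _ 0] by simp
qed

lemma integral_rescaled:
  fixes F :: "real \<Rightarrow> real"
  assumes "admissible K t" "K > 0" "\<And>x. x \<notin> {1<..<2} \<Longrightarrow> F x = 0"
  shows "(LINT x|lborel_on (dom_of c). F (K * x - t)) = (LINT x|lborel. F x) / K"
proof -
  have off: "F (K * x - t) = 0" if "x \<notin> {1..2}" for x
  proof (rule assms(3))
    show "K * x - t \<notin> {1<..<2}"
    proof
      assume "K * x - t \<in> {1<..<2}"
      hence "x \<in> {1<..<2}" using assms(1) unfolding admissible_def by blast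
      thus False using that by simp
    qed
  qed
  have "(LINT x|lborel_on (dom_of c). F (K * x - t)) = (LINT x|lborel. indicator {1..2} x *\<^sub>R F (K * x - t))"
    by (rule integral_dom_of_supported[OF off])
  also have "\<dots> = (LINT x|lborel. F (- t + K * x))"
    using off by (intro Bochner_Integration.integral_cong) (auto simp: indicator_def)
  also have "\<dots> = (LINT x|lborel. F x) / K"
    using lborel_integral_real_affine[of K F "- t"] assms(2) by simp
  finally show ?thesis .
qed

definition base_density :: "real \<Rightarrow> real" where
  "base_density x = bump x / bump_mass"

text \<open>The shifts are chosen so that the supports of the \<open>K\<close> copies tile \<open>[5/4, 7/4]\<close>, where the base density
  is bounded away from zero.\<close>

definition shift :: "nat \<Rightarrow> nat \<Rightarrow> real" where
  "shift K k = 5 / 2 * real K + real k - 1"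

definition wiggle :: "nat \<Rightarrow> nat \<Rightarrow> real \<Rightarrow> real" where
  "wiggle K k x = deriv bump (2 * real K * x - shift K k)"

definition perturbed :: "nat \<Rightarrow> real \<Rightarrow> nat set \<Rightarrow> real \<Rightarrow> real" where
  "perturbed K \<epsilon> S x = base_density x + \<epsilon> * (\<Sum>k\<in>S. wiggle K k x)"

text \<open>The window of copy \<open>k\<close> is the interval from \<open>5/4 + k / (2 K)\<close>
  to \<open>5/4 + (k + 1) / (2 K)\<close>. The frequency \<open>2 K\<close> makes \<open>K\<close>
  such cells fill a length of \<open>1/2\<close>.\<close>

lemma shift_window:
  assumes "k < K" "2 * real K * x - shift K k \<in> {1<..<2}"
  shows "x \<in> {5/4..7/4}"
proof -
  have K: "real K > 0" "real k + 1 \<le> real K" using assms(1) by auto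
  have "5 / 2 * real K + real k < 2 * real K * x" "2 * real K * x < 5 / 2 * real K + real k + 1"
    using assms(2) by (auto simp: shift_def)
  hence "real K * (5 / 4) \<le> real K * x" "real K * x \<le> real K * (7 / 4)"
    using K by linarith+
  thus ?thesis using K(1) by simp
qed

lemma admissible_shift:
  assumes "k < K" shows "admissible (2 * real K) (shift K k)"
  unfolding admissible_def
proof (intro allI impI)
  fix x assume "2 * real K * x - shift K k \<in> {1<..<2}"
  from shift_window[OF assms this] show "x \<in> {1<..<2}" by simp
qed

lemma shift_separated: "k \<noteq> k' \<Longrightarrow> 1 \<le> \<bar>shift K k - shift K k'\<bar>"
  unfolding shift_def by (cases "k < k'") auto

lemma admissible_1_0: "admissible 1 0"
  by (simp add: admissible_def)

lemma wiggle_eq_0: "k < K \<Longrightarrow> x \<notin> {5/4..7/4} \<Longrightarrow> wiggle K k x = 0"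
  unfolding wiggle_def by (rule deriv_bump_eq_0) (use shift_window in blast)

lemma wiggle_mult_eq_0: "k \<noteq> k' \<Longrightarrow> wiggle K k x * wiggle K k' x = 0"
proof (rule ccontr)
  assume "k \<noteq> k'" "wiggle K k x * wiggle K k' x \<noteq> 0"
  hence "2 * real K * x - shift K k \<in> {1<..<2}" "2 * real K * x - shift K k' \<in> {1<..<2}"
    using deriv_bump_eq_0 unfolding wiggle_def mult_eq_0_iff by blast+
  thus False using shift_separated[OF \<open>k \<noteq> k'\<close>, of K] by auto
qed

lemma wiggle_L2: "k < K \<Longrightarrow> wiggle K k \<in> L2 (dom_of c)"
  using osc_L2[OF osc_deriv_bump admissible_shift] unfolding wiggle_def[abs_def] by blast

lemma base_density_L2: "base_density \<in> L2 (dom_of c)"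
  using L2_scale[OF osc_L2[OF osc_bump_deriv[of 0 0] admissible_1_0], of "1 / bump_mass"]
  by (simp add: base_density_def[abs_def])

lemma perturbed_L2: "S \<subseteq> {..<K} \<Longrightarrow> perturbed K \<epsilon> S \<in> L2 (dom_of c)"
  unfolding perturbed_def[abs_def]
  by (intro L2_add base_density_L2 L2_scale L2_sum wiggle_L2) auto

lemma integral_base_density: "(LINT x|lborel_on (dom_of c). base_density x) = 1"
  using integral_rescaled[OF admissible_1_0, of bump c] bump_deriv_eq_0[of _ 0] bump_mass_pos
  by (simp add: base_density_def bump_mass_def)

text \<open>A nonintegrable function has integral 0 by convention, so an integral equal to 1 forces
  integrability.\<close>

lemma integrable_base_density: "integrable (lborel_on (dom_of c)) base_density"
  using integral_base_density[of c] not_integrable_integral_eq by fastforce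

lemma integrable_wiggle:
  assumes "k < K" shows "integrable (lborel_on (dom_of c)) (wiggle K k)"
  by (rule integrable_dom_of_supported)
     (use continuous_on_osc[OF osc_deriv_bump[of 0]] wiggle_eq_0[OF assms] in
       \<open>auto simp: wiggle_def[abs_def]\<close>)

lemma integral_wiggle: "k < K \<Longrightarrow> (LINT x|lborel_on (dom_of c). wiggle K k x) = 0"
  unfolding wiggle_def
  by (subst integral_rescaled) (auto simp: admissible_shift deriv_bump_eq_0 integral_deriv_bump)

lemma L2_inner_wiggle:
  assumes "i < K" "j < K"
  shows "L2_inner (dom_of c) (wiggle K i) (wiggle K j) =
    (if i = j then bump_energy / (2 * real K) else 0)"
proof (cases "i = j")
  case True
  have "L2_inner (dom_of c) (wiggle K i) (wiggle K i) =
      (LINT x|lborel_on (dom_of c). (\<lambda>y. (deriv bump y)\<^sup>2) (2 * real K * x - shift K i))"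
    unfolding L2_inner_def wiggle_def power2_eq_square ..
  also have "\<dots> = bump_energy / (2 * real K)"
    using assms unfolding bump_energy_def
    by (intro integral_rescaled admissible_shift) (auto simp: deriv_bump_eq_0)
  finally show ?thesis using True by simp
qed (simp add: L2_inner_def wiggle_mult_eq_0)

lemma base_density_nonneg: "0 \<le> base_density x"
  using bump_nonneg bump_mass_pos by (simp add: base_density_def)

text \<open>A minimum attained on a compact interval away from the zeros at 1 and 2. The bound
  \<open>b\<close> limits the amplitude that keeps the densities nonnegative and also enters the
  chi-square estimate.\<close>

lemma base_density_lower_bound: "\<exists>b>0. \<forall>x\<in>{5/4..7/4}. b \<le> base_density x"
proof -
  obtain y where y: "y \<in> {5/4..7/4}" "\<And>x. x \<in> {5/4..7/4} \<Longrightarrow> bump y \<le> bump x"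
    using continuous_attains_inf[of "{5/4..7/4}" bump] continuous_on_bump_deriv[of _ 0] by auto
  have "base_density y > 0"
    using y(1) bump_pos[of y] bump_mass_pos by (simp add: base_density_def)
  moreover have "base_density y \<le> base_density x" if "x \<in> {5/4..7/4}" for x
    using y(2)[OF that] bump_mass_pos unfolding base_density_def by (intro divide_right_mono) auto
  ultimately show ?thesis by blast
qed

lemma base_density_measurable: "base_density \<in> borel_measurable (lborel_on (dom_of c))"
  by (rule L2_measurable) (rule base_density_L2)

text \<open>Inside \<open>[5/4, 7/4]\<close> at most one copy is active at a point, outside none is.
  The factor one half gives nonnegativity and confines the likelihood ratios to
  \<open>[1/2, 3/2]\<close>.\<close>

lemma perturbation_le_half:
  assumes S: "S \<subseteq> {..<K}" and "0 \<le> \<epsilon>" and b: "\<And>x. x \<in> {5/4..7/4} \<Longrightarrow> b \<le> base_density x"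
    and B: "\<And>x. \<bar>deriv bump x\<bar> \<le> B" and "\<epsilon> * B \<le> b / 2"
  shows "\<bar>\<epsilon> * (\<Sum>k\<in>S. wiggle K k x)\<bar> \<le> base_density x / 2"
proof (cases "x \<in> {5/4..7/4}")
  case True
  have "\<bar>\<Sum>k\<in>S. wiggle K k x\<bar> \<le> B"
    unfolding wiggle_def
    using sum_osc_bounded[OF osc_deriv_bump[of 0], of S "shift K" "2 * real K" x B]
      finite_subset[OF S] B shift_separated abs_ge_zero[THEN order_trans, OF B] by auto
  hence "\<bar>\<epsilon> * (\<Sum>k\<in>S. wiggle K k x)\<bar> \<le> \<epsilon> * B"
    using \<open>0 \<le> \<epsilon>\<close> by (simp add: abs_mult mult_left_mono)
  thus ?thesis using assms(5) b[OF True] by simp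
next
  case False
  have "(\<Sum>k\<in>S. wiggle K k x) = 0"
    using S False by (intro sum.neutral) (auto intro: wiggle_eq_0)
  thus ?thesis using base_density_nonneg[of x] by simp
qed

lemma integral_perturbed:
  assumes "S \<subseteq> {..<K}"
  shows "integrable (lborel_on (dom_of c)) (perturbed K \<epsilon> S)"
    and "(LINT x|lborel_on (dom_of c). perturbed K \<epsilon> S x) = 1"
proof -
  have int: "integrable (lborel_on (dom_of c)) (wiggle K k)" if "k \<in> S" for k
    using assms that by (intro integrable_wiggle) auto
  show "integrable (lborel_on (dom_of c)) (perturbed K \<epsilon> S)"
    unfolding perturbed_def[abs_def]
    by (intro Bochner_Integration.integrable_add integrable_base_density
         integrable_mult_right Bochner_Integration.integrable_sum int)
  have "(LINT x|lborel_on (dom_of c). perturbed K \<epsilon> S x) =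
      1 + \<epsilon> * (LINT x|lborel_on (dom_of c). (\<Sum>k\<in>S. wiggle K k x))"
    unfolding perturbed_def
    by (subst Bochner_Integration.integral_add)
       (auto intro!: integrable_base_density Bochner_Integration.integrable_sum int integrable_mult_right simp: integral_base_density)
  also have "(LINT x|lborel_on (dom_of c). (\<Sum>k\<in>S. wiggle K k x)) =
      (\<Sum>k\<in>S. LINT x|lborel_on (dom_of c). wiggle K k x)"
    by (intro Bochner_Integration.integral_sum int)
  also have "\<dots> = 0"
    using assms by (intro sum.neutral) (auto intro: integral_wiggle)
  finally show "(LINT x|lborel_on (dom_of c). perturbed K \<epsilon> S x) = 1" by simp
qed

lemma perturbed_prob_density:
  assumes S: "S \<subseteq> {..<K}" and nonneg: "\<And>x. 0 \<le> perturbed K \<epsilon> S x"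
  shows "prob_density_on (dom_of c) (perturbed K \<epsilon> S)"
  unfolding prob_density_on_def
  using integral_perturbed[OF S, of c \<epsilon>] nonneg
  by (auto simp: nn_integral_eq_integral borel_measurable_integrable)

text \<open>The base law replaces Lebesgue measure as reference, because the densities relative to
  it lie in \<open>[1/2, 3/2]\<close>. Switching on copy \<open>k\<close> adds
  \<open>\<epsilon>\<close> times \<open>wiggle K k\<close>, of norm
  \<open>\<epsilon> * sqrt w\<close> with \<open>w = bump_energy / (2 K)\<close>; this norm is the
  separation \<open>d\<close> in Assouad's lemma.\<close>

lemma risk_lower_bound:
  assumes K: "K > 0" and n: "n > 0" and \<epsilon>: "0 \<le> \<epsilon>"
    and b: "b > 0" "\<And>x. x \<in> {5/4..7/4} \<Longrightarrow> b \<le> base_density x"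
    and B: "\<And>x. \<bar>deriv bump x\<bar> \<le> B" "\<epsilon> * B \<le> b / 2"
    and chi: "\<epsilon>\<^sup>2 * (bump_energy / (2 * real K)) / b \<le> 1 / (4 * real n)"
    and est: "estimator c n fhat"
    and D: "\<And>S. S \<subseteq> {..<K} \<Longrightarrow> perturbed K \<epsilon> S \<in> D"
  shows "ennreal (\<epsilon>\<^sup>2 * bump_energy / 16) \<le> (SUP f\<in>D. risk c n fhat f)"
proof -
  let ?M = "lborel_on (dom_of c)"
  define \<mu> where "\<mu> = law_of c base_density"
  \<comment> \<open>Where the base density vanishes the quotient is 0 by convention and
    \<open>h\<close> is 1; the perturbation vanishes there too, so the base density times
    \<open>h\<close> is still the perturbed density.\<close>
  define h where "h S x = 1 + \<epsilon> * (\<Sum>k\<in>S. wiggle K k x) / base_density x" for S x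
  define w where "w = bump_energy / (2 * real K)"
  have w: "w > 0" using bump_energy_pos K by (simp add: w_def)
  have half: "\<bar>\<epsilon> * (\<Sum>k\<in>S. wiggle K k x)\<bar> \<le> base_density x / 2" if "S \<subseteq> {..<K}" for S x
    by (rule perturbation_le_half[OF that \<epsilon> b(2) B])
  have mult: "base_density x * h S x = perturbed K \<epsilon> S x" if "S \<subseteq> {..<K}" for S x
    using half[OF that, of x] by (cases "base_density x = 0") (auto simp: h_def perturbed_def field_simps)
  have \<mu>: "prob_space \<mu>"
  proof (rule prob_spaceI)
    have "emeasure \<mu> (space \<mu>) = (\<integral>\<^sup>+x. ennreal (base_density x) * indicator (space ?M) x \<partial>?M)"
      unfolding \<mu>_def law_of_def space_density using base_density_measurable
      by (intro emeasure_density sets.top) auto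
    also have "\<dots> = (\<integral>\<^sup>+x. ennreal (base_density x) \<partial>?M)"
      by (intro nn_integral_cong) auto
    also have "\<dots> = 1"
      using integral_base_density[of c] base_density_nonneg
      by (subst nn_integral_eq_integral[OF integrable_base_density]) auto
    finally show "emeasure \<mu> (space \<mu>) = 1" .
  qed
  have sets_\<mu>: "sets \<mu> = sets (restrict_space borel (dom_of c))"
    by (simp add: \<mu>_def law_of_def sets_restrict_space)
  have int_\<mu>: "(LINT x|\<mu>. g x) = (LINT x|?M. base_density x * g x)" if "g \<in> borel_measurable ?M" for g
    unfolding \<mu>_def law_of_def using base_density_nonneg base_density_measurable that
    by (subst integral_density) auto
  have h_meas: "h S \<in> borel_measurable ?M" if "S \<subseteq> {..<K}" for S
    unfolding h_def[abs_def] using that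
    by (intro borel_measurable_add borel_measurable_const borel_measurable_divide borel_measurable_times
         base_density_measurable borel_measurable_sum L2_measurable[OF wiggle_L2]) auto
  have h_range: "h S x \<in> {1/2..3/2}" if "S \<subseteq> {..<K}" for S x
  proof -
    have "\<bar>\<epsilon> * (\<Sum>k\<in>S. wiggle K k x) / base_density x\<bar> \<le> 1/2"
      using half[OF that, of x] base_density_nonneg[of x]
      by (cases "base_density x = 0") (auto simp: abs_divide field_simps)
    moreover have "1 + r \<in> {1/2..3/2}" if "\<bar>r\<bar> \<le> 1/2" for r :: real
      using that by (auto simp: abs_le_iff)
    ultimately show ?thesis unfolding h_def by blast
  qed
  have h_int: "(LINT x|\<mu>. h S x) = 1" if "S \<subseteq> {..<K}" for S
    using int_\<mu>[OF h_meas[OF that]] mult[OF that] integral_perturbed(2)[OF that] by simp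
  have h_chi: "(LINT x|\<mu>. (h (insert k S) x - h S x)\<^sup>2) \<le> 1 / (4 * real n)"
    if S: "S \<subseteq> {..<K}" and k: "k < K" "k \<notin> S" for S k
  proof -
    have fin: "finite S" using S finite_subset by blast
    have diff: "h (insert k S) x - h S x = \<epsilon> * wiggle K k x / base_density x" for x
      using fin k by (simp add: h_def algebra_simps add_divide_distrib)
    have "(LINT x|\<mu>. (h (insert k S) x - h S x)\<^sup>2) =
        (LINT x|?M. base_density x * (h (insert k S) x - h S x)\<^sup>2)"
      using h_meas[of S] h_meas[of "insert k S"] S k by (intro int_\<mu>) auto
    also have "\<dots> \<le> (LINT x|?M. \<epsilon>\<^sup>2 / b * (wiggle K k x * wiggle K k x))"
    proof (rule integral_mono')
      show "integrable ?M (\<lambda>x. \<epsilon>\<^sup>2 / b * (wiggle K k x * wiggle K k x))"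
        using k by (intro integrable_mult_right L2_mult_integrable wiggle_L2)
      show "base_density x * (h (insert k S) x - h S x)\<^sup>2 \<le> \<epsilon>\<^sup>2 / b * (wiggle K k x * wiggle K k x)" for x
      proof (cases "wiggle K k x = 0")
        case False
        hence x: "b \<le> base_density x" using wiggle_eq_0[OF k(1)] b(2) by blast
        hence "base_density x * (h (insert k S) x - h S x)\<^sup>2 = (\<epsilon> * wiggle K k x)\<^sup>2 / base_density x"
          unfolding diff using b(1) by (simp add: power2_eq_square)
        also have "\<dots> \<le> (\<epsilon> * wiggle K k x)\<^sup>2 / b"
          using x b(1) by (intro divide_left_mono) auto
        finally show ?thesis by (simp add: power2_eq_square mult_ac)
      qed (simp add: diff)
      show "0 \<le> \<epsilon>\<^sup>2 / b * (wiggle K k x * wiggle K k x)" for x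
        using b(1) by simp
    qed
    also have "\<dots> = \<epsilon>\<^sup>2 / b * w"
      using L2_inner_wiggle[OF k(1) k(1), of c] by (simp add: L2_inner_def w_def)
    also have "\<dots> \<le> 1 / (4 * real n)"
      using chi by (simp add: w_def mult_ac)
    finally show ?thesis .
  qed
  have law: "law_of c (perturbed K \<epsilon> S) = density \<mu> (\<lambda>x. ennreal (h S x))" if "S \<subseteq> {..<K}" for S
  proof -
    have "ennreal (perturbed K \<epsilon> S x) = ennreal (base_density x) * ennreal (h S x)" for x
      using h_range[OF that, of x] base_density_nonneg[of x] by (simp flip: mult[OF that] add: ennreal_mult)
    thus ?thesis
      unfolding \<mu>_def law_of_def using h_meas[OF that] base_density_measurable[of c]
      by (simp add: density_density_eq)
  qed
  have sets_PiM: "sets (PiM {..<n} (\<lambda>_. \<mu>)) = sets (PiM {..<n} (\<lambda>_. restrict_space borel (dom_of c)))"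
    by (intro sets_PiM_cong refl sets_\<mu>)
  have fhat: "fhat \<in> PiM {..<n} (\<lambda>_. \<mu>) \<rightarrow>\<^sub>M L2_borel (dom_of c)"
    using est unfolding estimator_def by (simp cong: measurable_cong_sets add: sets_PiM)
  define loss where "loss S X = (L2_norm (dom_of c) (\<lambda>x. fhat X x - perturbed K \<epsilon> S x))\<^sup>2" for S X
  have loss_meas: "loss S \<in> borel_measurable (PiM {..<n} (\<lambda>_. \<mu>))" if "S \<subseteq> {..<K}" for S
    unfolding loss_def[abs_def]
    using measurable_compose[OF fhat borel_measurable_L2_dist[OF perturbed_L2[OF that]]]
    by (intro borel_measurable_power)
  have sep: "\<exists>a. \<forall>S\<subseteq>{..<K}. (\<Sum>k<K. (a k - (if k \<in> S then \<epsilon> * sqrt w else 0))\<^sup>2) \<le> loss S X"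
    if X: "X \<in> space (PiM {..<n} (\<lambda>_. \<mu>))" for X
  proof -
    have fX: "fhat X \<in> L2 (dom_of c)"
      using measurable_space[OF fhat X] by (simp add: space_L2_borel)
    \<comment> \<open>Coordinates of \<open>fhat X - base_density\<close> along the normalized
      copies. By orthogonality a switch shifts only its own coordinate, by
      \<open>\<epsilon> * sqrt w\<close>, and Bessel's inequality bounds the coordinate error by the
      loss.\<close>
    define a where "a k = L2_inner (dom_of c) (\<lambda>x. fhat X x - base_density x) (wiggle K k) / sqrt w" for k
    have "(\<Sum>k<K. (a k - (if k \<in> S then \<epsilon> * sqrt w else 0))\<^sup>2) \<le> loss S X" if S: "S \<subseteq> {..<K}" for S
    proof -
      let ?r = "\<lambda>x. fhat X x - perturbed K \<epsilon> S x"
      have r: "?r \<in> L2 (dom_of c)" by (intro L2_diff fX perturbed_L2 S)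
      have "L2_inner (dom_of c) ?r (wiggle K k) = sqrt w * (a k - (if k \<in> S then \<epsilon> * sqrt w else 0))"
        if k: "k < K" for k
      proof -
        have gS: "(\<lambda>x. \<Sum>k\<in>S. wiggle K k x) \<in> L2 (dom_of c)"
          using S by (intro L2_sum wiggle_L2) auto
        have "L2_inner (dom_of c) (\<lambda>x. \<Sum>i\<in>S. wiggle K i x) (wiggle K k) =
            (\<Sum>i\<in>S. L2_inner (dom_of c) (wiggle K i) (wiggle K k))"
          using S k by (intro L2_inner_sum_left wiggle_L2) auto
        also have "\<dots> = (\<Sum>i\<in>S. if i = k then w else 0)"
          using S k by (intro sum.cong refl) (subst L2_inner_wiggle, auto simp: w_def)
        also have "\<dots> = (if k \<in> S then w else 0)"
          using finite_subset[OF S] by simp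
        finally have inner: "L2_inner (dom_of c) (\<lambda>x. \<Sum>i\<in>S. wiggle K i x) (wiggle K k) = (if k \<in> S then w else 0)" .
        have "?r = (\<lambda>x. (fhat X x - base_density x) - \<epsilon> * (\<Sum>k\<in>S. wiggle K k x))"
          by (simp add: perturbed_def fun_eq_iff)
        hence "L2_inner (dom_of c) ?r (wiggle K k) = L2_inner (dom_of c) (\<lambda>x. fhat X x - base_density x) (wiggle K k)
            - \<epsilon> * (if k \<in> S then w else 0)"
          using k gS fX by (simp add: L2_inner_diff_left L2_diff L2_scale base_density_L2 wiggle_L2
              L2_inner_scale_left inner)
        thus ?thesis using w by (simp add: a_def right_diff_distrib mult_ac)
      qed
      hence "(\<Sum>k<K. w * (a k - (if k \<in> S then \<epsilon> * sqrt w else 0))\<^sup>2) =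
          (\<Sum>k<K. (L2_inner (dom_of c) ?r (wiggle K k))\<^sup>2)"
        using w by (intro sum.cong refl) (simp add: power_mult_distrib)
      also have "\<dots> \<le> w * loss S X"
        using bessel_inequality[OF r, of "{..<K}" "wiggle K" w] w
        by (simp add: loss_def L2_norm_power2 wiggle_L2 L2_inner_wiggle w_def)
      finally show ?thesis using w by (simp flip: sum_distrib_left)
    qed
    thus ?thesis by blast
  qed
  have "ennreal (2 ^ K) * ennreal (real K * (\<epsilon> * sqrt w)\<^sup>2 / 8) =
      ennreal (2 ^ K * (real K * (\<epsilon> * sqrt w)\<^sup>2 / 8))"
    by (rule ennreal_mult'[symmetric]) simp
  also have "\<dots> \<le>
    (\<Sum>S\<in>Pow {..<K}. \<integral>\<^sup>+X. ennreal (loss S X) \<partial>PiM {..<n} (\<lambda>_. density \<mu> (\<lambda>x. ennreal (h S x))))"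
  proof (rule assouad[OF \<mu> n])
    show "h S \<in> borel_measurable \<mu>" if "S \<subseteq> {..<K}" for S
      using h_meas[OF that] by (simp add: \<mu>_def law_of_def)
  qed (use h_range h_int h_chi loss_meas sep in blast)+
  also have "\<dots> = (\<Sum>S\<in>Pow {..<K}. risk c n fhat (perturbed K \<epsilon> S))"
    by (intro sum.cong refl) (simp add: risk_def law loss_def)
  also have "\<dots> \<le> (\<Sum>S\<in>Pow {..<K}. (SUP f\<in>D. risk c n fhat f))"
    using D by (intro sum_mono SUP_upper) auto
  also have "\<dots> = ennreal (2 ^ K) * (SUP f\<in>D. risk c n fhat f)"
    by (simp add: card_Pow ennreal_of_nat_eq_real_of_nat)
  finally have "ennreal (2 ^ K) * ennreal (real K * (\<epsilon> * sqrt w)\<^sup>2 / 8) \<le>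
      ennreal (2 ^ K) * (SUP f\<in>D. risk c n fhat f)" .
  hence "ennreal (real K * (\<epsilon> * sqrt w)\<^sup>2 / 8) \<le> (SUP f\<in>D. risk c n fhat f)"
    by (subst (asm) ennreal_mult_le_mult_iff) auto
  \<comment> \<open>The number of copies cancels, since
    \<open>K w = bump_energy / 2\<close>.\<close>
  moreover have "real K * (\<epsilon> * sqrt w)\<^sup>2 / 8 = \<epsilon>\<^sup>2 * bump_energy / 16"
    using w K by (simp add: power_mult_distrib) (simp add: w_def)
  ultimately show ?thesis by simp
qed

section \<open>Membership in the density class\<close>

lemma perturbed_eq_0: "S \<subseteq> {..<K} \<Longrightarrow> x \<notin> {1..2} \<Longrightarrow> perturbed K \<epsilon> S x = 0"
  using bump_deriv_eq_0[of x 0] wiggle_eq_0[of _ K x]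
  by (auto simp: perturbed_def base_density_def subset_iff intro!: sum.neutral)

lemma perturbed_moment_le:
  assumes S: "S \<subseteq> {..<K}" and nonneg: "\<And>x. 0 \<le> perturbed K \<epsilon> S x"
  shows "(\<integral>\<^sup>+x. ennreal (\<bar>x\<bar> powr (alpha_of c * real m)) \<partial>law_of c (perturbed K \<epsilon> S)) \<le> ennreal (2 ^ m)"
proof -
  let ?M = "lborel_on (dom_of c)"
  have meas: "perturbed K \<epsilon> S \<in> borel_measurable ?M"
    by (rule L2_measurable) (rule perturbed_L2[OF S])
  have "\<bar>x\<bar> powr (alpha_of c * real m) \<le> 2 ^ m" if x: "x \<in> {1..2}" for x
  proof -
    \<comment> \<open>In both cases \<open>alpha_of c \<le> 1\<close>, and \<open>x \<ge> 1\<close>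
      makes powers monotone in the exponent; this covers the negative exponent of the Laguerre case
      too.\<close>
    have "x powr (alpha_of c * real m) \<le> x powr real m"
      using x by (intro powr_mono) (cases c; simp)+
    also have "\<dots> \<le> 2 powr real m"
      using x by (intro powr_mono2) auto
    finally show ?thesis using x by (simp add: powr_realpow)
  qed
  hence "(\<integral>\<^sup>+x. ennreal (perturbed K \<epsilon> S x) * ennreal (\<bar>x\<bar> powr (alpha_of c * real m)) \<partial>?M) \<le>
      (\<integral>\<^sup>+x. ennreal (perturbed K \<epsilon> S x) * ennreal (2 ^ m) \<partial>?M)"
    using perturbed_eq_0[OF S] by (intro nn_integral_mono) (metis ennreal_leI mult_left_mono mult_zero_left ennreal_0 zero_le)
  also have "\<dots> = ennreal (2 ^ m)"
    using perturbed_prob_density[OF S nonneg, of c] meas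
    by (simp add: nn_integral_multc prob_density_on_def del: ennreal_power)
  finally show ?thesis
    unfolding law_of_def using meas
    by (subst nn_integral_density) (auto intro!: measurable_compose[OF _ measurable_ennreal] measurable_restrict_space1)
qed

lemma sobolev_sq_le:
  assumes "\<And>N. (\<Sum>j<N. real j powr s * (basis_coeff c j f)\<^sup>2) \<le> B"
  shows "sobolev_sq c s f \<le> ennreal B"
  unfolding sobolev_sq_def
proof (rule suminf_le_const)
  show "(\<Sum>j<N. ennreal (real j powr s * \<bar>basis_coeff c j f\<bar>\<^sup>2)) \<le> ennreal B" for N
    using assms[of N] by (subst sum_ennreal) (auto intro: ennreal_leI)
qed simp

lemma perturbed_sobolev_le:
  assumes S: "S \<subseteq> {..<K}"
    and base: "(\<Sum>j<N. real j powr s * (basis_coeff c j bump)\<^sup>2) \<le> B\<^sub>0"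
    and pert: "(\<Sum>j<N. real j powr s * (basis_coeff c j (\<lambda>x. \<Sum>k\<in>S. wiggle K k x))\<^sup>2) \<le> B\<^sub>1"
  shows "(\<Sum>j<N. real j powr s * (basis_coeff c j (perturbed K \<epsilon> S))\<^sup>2) \<le> 2 * B\<^sub>0 / bump_mass\<^sup>2 + 2 * \<epsilon>\<^sup>2 * B\<^sub>1"
proof -
  let ?a = "\<lambda>j. basis_coeff c j bump" and ?g = "\<lambda>j. basis_coeff c j (\<lambda>x. \<Sum>k\<in>S. wiggle K k x)"
  have g: "(\<lambda>x. \<Sum>k\<in>S. wiggle K k x) \<in> L2 (dom_of c)"
    using S by (intro L2_sum wiggle_L2) auto
  have coeff: "basis_coeff c j (perturbed K \<epsilon> S) = ?a j / bump_mass + \<epsilon> * ?g j" for j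
  proof -
    have "basis_coeff c j base_density = ?a j / bump_mass"
      unfolding basis_coeff_def using L2_inner_scale_left[of _ "1 / bump_mass" bump]
      by (simp add: base_density_def[abs_def])
    thus ?thesis
      unfolding basis_coeff_def perturbed_def[abs_def]
      by (subst L2_inner_add_left) (auto intro!: base_density_L2 L2_scale g basis_in_L2 simp: L2_inner_scale_left)
  qed
  have sq: "(x + y)\<^sup>2 \<le> 2 * x\<^sup>2 + 2 * y\<^sup>2" for x y :: real
    using zero_le_power2[of "x - y"] by (simp add: power2_sum power2_diff)
  have "(\<Sum>j<N. real j powr s * (basis_coeff c j (perturbed K \<epsilon> S))\<^sup>2) \<le>
      (\<Sum>j<N. real j powr s * (2 * (?a j / bump_mass)\<^sup>2 + 2 * (\<epsilon> * ?g j)\<^sup>2))"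
    unfolding coeff by (intro sum_mono mult_left_mono sq) auto
  also have "\<dots> = 2 / bump_mass\<^sup>2 * (\<Sum>j<N. real j powr s * (?a j)\<^sup>2) + 2 * \<epsilon>\<^sup>2 * (\<Sum>j<N. real j powr s * (?g j)\<^sup>2)"
    by (simp add: sum_distrib_left sum.distrib distrib_left power_divide power_mult_distrib mult_ac)
  also have "\<dots> \<le> 2 / bump_mass\<^sup>2 * B\<^sub>0 + 2 * \<epsilon>\<^sup>2 * B\<^sub>1"
    by (intro add_mono mult_left_mono base pert) auto
  finally show ?thesis by simp
qed

text \<open>The bump is itself a one-member family, at frequency 1 with shift 0, so the general
  bound applies.\<close>

lemma base_sobolev_bound:
  assumes "s > 0"
  shows "\<exists>B\<ge>0. \<forall>N. (\<Sum>j<N. real j powr s * (basis_coeff c j bump)\<^sup>2) \<le> B"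
proof (rule osc_sobolev_bound[OF osc_bump_deriv[of 0 0] assms, of c])
  fix B :: real
  assume "B \<ge> 0" and B: "\<And>K (I :: nat set) t N. K \<ge> 1 \<Longrightarrow> finite I \<Longrightarrow>
      (\<And>i. i \<in> I \<Longrightarrow> admissible K (t i)) \<Longrightarrow>
      (\<And>i i'. i \<in> I \<Longrightarrow> i' \<in> I \<Longrightarrow> i \<noteq> i' \<Longrightarrow> \<bar>t i - t i'\<bar> \<ge> 1) \<Longrightarrow>
      (\<Sum>j<N. real j powr s * (basis_coeff c j (\<lambda>x. \<Sum>i\<in>I. bump_deriv 0 (K * x - t i)))\<^sup>2) \<le> B * K powr (2 * s)"
  have "(\<Sum>j<N. real j powr s * (basis_coeff c j bump)\<^sup>2) \<le> B" for N
    using B[of 1 "{0}" "\<lambda>_. 0" N] admissible_1_0 by simp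
  thus ?thesis using \<open>B \<ge> 0\<close> by blast
qed

lemma wiggle_sobolev_bound:
  assumes "s > 0"
  shows "\<exists>B\<ge>0. \<forall>K S N. 0 < K \<longrightarrow> S \<subseteq> {..<K} \<longrightarrow>
    (\<Sum>j<N. real j powr s * (basis_coeff c j (\<lambda>x. \<Sum>k\<in>S. wiggle K k x))\<^sup>2) \<le> B * (2 * real K) powr (2 * s)"
proof (rule osc_sobolev_bound[OF osc_deriv_bump[of 0] assms, of c])
  fix B :: real
  assume "B \<ge> 0" and B: "\<And>K (I :: nat set) t N. K \<ge> 1 \<Longrightarrow> finite I \<Longrightarrow>
      (\<And>i. i \<in> I \<Longrightarrow> admissible K (t i)) \<Longrightarrow>
      (\<And>i i'. i \<in> I \<Longrightarrow> i' \<in> I \<Longrightarrow> i \<noteq> i' \<Longrightarrow> \<bar>t i - t i'\<bar> \<ge> 1) \<Longrightarrow>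
      (\<Sum>j<N. real j powr s * (basis_coeff c j (\<lambda>x. \<Sum>i\<in>I. deriv bump (K * x - t i)))\<^sup>2) \<le> B * K powr (2 * s)"
  have "(\<Sum>j<N. real j powr s * (basis_coeff c j (\<lambda>x. \<Sum>k\<in>S. wiggle K k x))\<^sup>2) \<le> B * (2 * real K) powr (2 * s)"
    if "0 < K" "S \<subseteq> {..<K}" for K S N
    unfolding wiggle_def using that
    by (intro B) (auto intro: admissible_shift shift_separated finite_subset)
  thus ?thesis using \<open>B \<ge> 0\<close> by blast
qed

text \<open>\<open>K\<close> is the floor of \<open>x = n powr (1 / (2 s + 1))\<close>. The
  threshold for \<open>n\<close> gives \<open>x \<ge> 8\<close>, hence
  \<open>x < K + 1 \<le> 2 K\<close>. The bound on \<open>K powr (2 s + 1)\<close> serves the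
  Sobolev condition, and \<open>K \<le> n\<close> keeps \<open>\<epsilon>^2\<close> below
  \<open>\<eta>\<close>.\<close>

lemma bandwidth_exists:
  fixes s :: real
  assumes s: "s > 0" and n: "real n \<ge> 8 powr (2 * s + 1)"
  shows "\<exists>K>0. real n powr (1 / (2 * s + 1)) \<le> 2 * real K \<and> real K powr (2 * s + 1) \<le> real n \<and> K \<le> n"
proof -
  define x where "x = real n powr (1 / (2 * s + 1))"
  define K where "K = nat \<lfloor>x\<rfloor>"
  have n1: "real n \<ge> 1"
    using n ge_one_powr_ge_zero[of 8 "2 * s + 1"] s by linarith
  have "8 = (8 powr (2 * s + 1)) powr (1 / (2 * s + 1))"
    using s by (simp add: powr_powr)
  also have "\<dots> \<le> x"
    unfolding x_def using n s by (intro powr_mono2) auto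
  finally have x8: "8 \<le> x" .
  have K: "real K \<le> x" "x < real K + 1"
    using x8 unfolding K_def by linarith+
  have "real K powr (2 * s + 1) \<le> x powr (2 * s + 1)"
    using K s by (intro powr_mono2) auto
  also have "\<dots> = real n"
    unfolding x_def using s n1 by (simp add: powr_powr)
  finally have Kn: "real K powr (2 * s + 1) \<le> real n" .
  have "x \<le> real n powr 1"
    unfolding x_def using s n1 by (intro powr_mono) auto
  hence "K \<le> n" using K n1 by simp
  thus ?thesis using K x8 Kn unfolding x_def[symmetric] by (intro exI[of _ K]) auto
qed

section \<open>Choice of the amplitude and conclusion\<close>

theorem theorem2p3:
  fixes c :: basis_case and m :: nat
  assumes "m \<ge> 1"
  shows "\<exists>C>0. \<forall>s>0. \<exists>L\<^sub>0>0. \<forall>(n::nat) (L::real) fhat.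
           real n \<ge> 8 powr (2 * s + 1) \<longrightarrow> L \<ge> L\<^sub>0 \<longrightarrow> estimator c n fhat \<longrightarrow>
           (SUP f\<in>density_class c s (real m) L. risk c n fhat f)
             \<ge> ennreal (C * real n powr (- 2 * s / (2 * s + 1)))"
proof -
  obtain b where b: "b > 0" "\<And>x. x \<in> {5/4..7/4} \<Longrightarrow> b \<le> base_density x"
    using base_density_lower_bound by blast
  obtain B where B: "B > 0" "\<And>x. \<bar>deriv bump x\<bar> \<le> B"
  proof -
    obtain B' where "B' \<ge> 0" "\<And>x. \<bar>deriv bump x\<bar> \<le> B'"
      using bump_deriv_bounded[of 1] by auto
    thus ?thesis by (intro that[of "B' + 1"]) (auto intro: add_increasing2)
  qed
  define W where "W = bump_energy"
  have W: "W > 0" unfolding W_def by (rule bump_energy_pos)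
  \<comment> \<open>The first entry ensures \<open>\<epsilon> * B \<le> b / 2\<close> as soon as
    \<open>\<epsilon>^2 \<le> \<eta>\<close>; the second is exactly the chi-square condition. Both
    depend only on the bump, so \<open>C\<close> can be fixed before \<open>s\<close>.\<close>
  define \<eta> where "\<eta> = min ((b / (2 * B))\<^sup>2) (b / (2 * W))"
  have \<eta>: "\<eta> > 0" "\<eta> \<le> (b / (2 * B))\<^sup>2" "\<eta> \<le> b / (2 * W)"
    using b B W by (auto simp: \<eta>_def)
  show ?thesis
  proof (rule exI[of _ "\<eta> * W / 32"], intro conjI allI impI)
    show "0 < \<eta> * W / 32" using \<eta> W by simp
    fix s :: real assume s: "s > 0"
    obtain B\<^sub>0 where B0: "B\<^sub>0 \<ge> 0" "\<And>N. (\<Sum>j<N. real j powr s * (basis_coeff c j bump)\<^sup>2) \<le> B\<^sub>0"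
      using base_sobolev_bound[OF s] by blast
    obtain B\<^sub>1 where B1: "B\<^sub>1 \<ge> 0" "\<And>K S N. 0 < K \<Longrightarrow> S \<subseteq> {..<K} \<Longrightarrow>
      (\<Sum>j<N. real j powr s * (basis_coeff c j (\<lambda>x. \<Sum>k\<in>S. wiggle K k x))\<^sup>2) \<le> B\<^sub>1 * (2 * real K) powr (2 * s)"
      using wiggle_sobolev_bound[OF s] by blast
    \<comment> \<open>One summand for the base density, one for the perturbation. The factors 2 come
      from \<open>(x + y)^2 \<le> 2 x^2 + 2 y^2\<close>, and \<open>2 powr (2 * s)\<close> from the
      frequency \<open>2 K\<close> after \<open>K powr (2 s + 1) \<le> n\<close> has removed
      \<open>K\<close> and \<open>n\<close>.\<close>
    define A where "A = 2 * B\<^sub>0 / bump_mass\<^sup>2 + 2 * (\<eta> * B\<^sub>1 * 2 powr (2 * s))"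
    have A: "A \<ge> 0" using B0 B1 \<eta> by (simp add: A_def)
    show "\<exists>L\<^sub>0>0. \<forall>(n::nat) (L::real) fhat.
           real n \<ge> 8 powr (2 * s + 1) \<longrightarrow> L \<ge> L\<^sub>0 \<longrightarrow> estimator c n fhat \<longrightarrow>
           (SUP f\<in>density_class c s (real m) L. risk c n fhat f)
             \<ge> ennreal (\<eta> * W / 32 * real n powr (- 2 * s / (2 * s + 1)))"
    \<comment> \<open>The threshold dominates both the Sobolev bound \<open>A\<close> and the moment
      bound \<open>2 ^ m\<close>.\<close>
    proof (rule exI[of _ "A + 2 ^ m"], intro conjI allI impI)
      show "0 < A + 2 ^ m" using A by (simp add: add_nonneg_pos)
      fix n :: nat and L :: real and fhat
      assume n8: "8 powr (2 * s + 1) \<le> real n" and L: "A + 2 ^ m \<le> L" and est: "estimator c n fhat"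
      obtain K where K: "K > 0" "real n powr (1 / (2 * s + 1)) \<le> 2 * real K"
        "real K powr (2 * s + 1) \<le> real n" "K \<le> n"
        using bandwidth_exists[OF s n8] by blast
      have n: "n > 0" using K by simp
      \<comment> \<open>With this amplitude one copy has squared norm
        \<open>\<epsilon>^2 W / (2 K) = \<eta> W / (2 n)\<close>, which is of order
        \<open>1 / n\<close> whatever \<open>K\<close> is.\<close>
      define \<epsilon> where "\<epsilon> = sqrt (\<eta> * real K / real n)"
      have \<epsilon>: "\<epsilon> \<ge> 0" "\<epsilon>\<^sup>2 = \<eta> * real K / real n"
        using \<eta> by (auto simp: \<epsilon>_def)
      have \<epsilon>B: "\<epsilon> * B \<le> b / 2"
      proof -
        have "\<eta> * (real K / real n) \<le> \<eta> * 1"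
          using \<eta> K n by (intro mult_left_mono) auto
        hence "\<epsilon>\<^sup>2 \<le> (b / (2 * B))\<^sup>2" using \<epsilon>(2) \<eta>(2) by simp
        hence "\<epsilon> \<le> b / (2 * B)" by (rule power2_le_imp_le) (use b B in simp)
        thus ?thesis using B by (simp add: field_simps)
      qed
      have chi: "\<epsilon>\<^sup>2 * (bump_energy / (2 * real K)) / b \<le> 1 / (4 * real n)"
      proof -
        have "\<eta> * (2 * W) \<le> b" using \<eta>(3) W by (simp add: field_simps)
        hence "\<eta> * W / b \<le> 1 / 2" using b by (simp add: field_simps)
        hence "(\<eta> * W / b) / (2 * real n) \<le> (1 / 2) / (2 * real n)"
          by (intro divide_right_mono) auto
        moreover have "\<epsilon>\<^sup>2 * (bump_energy / (2 * real K)) / b = (\<eta> * W / b) / (2 * real n)"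
          unfolding \<epsilon>(2) W_def using K by simp
        ultimately show ?thesis by simp
      qed
      have smooth: "\<epsilon>\<^sup>2 * (B\<^sub>1 * (2 * real K) powr (2 * s)) \<le> \<eta> * B\<^sub>1 * 2 powr (2 * s)"
      proof -
        have "real K * real K powr (2 * s) = real K powr (2 * s + 1)"
          using K by (simp add: powr_add)
        hence "real K * real K powr (2 * s) / real n \<le> 1" using K n by simp
        hence "\<eta> * B\<^sub>1 * 2 powr (2 * s) * (real K * real K powr (2 * s) / real n) \<le> \<eta> * B\<^sub>1 * 2 powr (2 * s) * 1"
          using \<eta> B1 by (intro mult_left_mono) auto
        thus ?thesis unfolding \<epsilon>(2) by (simp add: powr_mult mult_ac)
      qed
      have D: "perturbed K \<epsilon> S \<in> density_class c s (real m) L" if S: "S \<subseteq> {..<K}" for S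
      proof -
        have nonneg: "0 \<le> perturbed K \<epsilon> S x" for x
          using perturbation_le_half[OF S \<epsilon>(1) b(2) B(2) \<epsilon>B, of x] base_density_nonneg[of x]
          by (auto simp: perturbed_def)
        have "sobolev_sq c s (perturbed K \<epsilon> S) \<le> ennreal A"
        proof (rule sobolev_sq_le)
          fix N
          show "(\<Sum>j<N. real j powr s * (basis_coeff c j (perturbed K \<epsilon> S))\<^sup>2) \<le> A"
            using perturbed_sobolev_le[OF S B0(2) B1(2)[OF K(1) S], where N = N and \<epsilon> = \<epsilon>] smooth
            unfolding A_def by linarith
        qed
        also have "\<dots> \<le> ennreal L" using L by (intro ennreal_leI) (simp add: order_trans[OF _ L])
        finally have "sobolev_sq c s (perturbed K \<epsilon> S) \<le> ennreal L" .
        moreover have "ennreal (2 ^ m) \<le> ennreal L"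
          using L A by (intro ennreal_leI) linarith
        ultimately show ?thesis
          unfolding density_class_def
          using perturbed_L2[OF S] perturbed_prob_density[OF S nonneg] perturbed_moment_le[OF S nonneg, of c m]
          by auto
      qed
      \<comment> \<open>The rate is \<open>x / n\<close> with
        \<open>x = n powr (1 / (2 s + 1)) \<le> 2 K\<close>, hence at most \<open>2 K / n\<close>, a
        multiple of \<open>\<epsilon>^2\<close>; the 32 in \<open>C\<close> is the 16 of the risk
        bound times this 2.\<close>
      have "real n powr (- 2 * s / (2 * s + 1)) = real n powr (1 / (2 * s + 1)) / real n"
      proof -
        have "- 2 * s / (2 * s + 1) = 1 / (2 * s + 1) - 1"
          using s by (simp add: field_simps)
        thus ?thesis using n by (simp add: powr_diff)
      qed
      also have "\<dots> \<le> 2 * real K / real n"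
        by (intro divide_right_mono K(2)) simp
      finally have "\<eta> * W / 32 * real n powr (- 2 * s / (2 * s + 1)) \<le> \<eta> * W / 32 * (2 * real K / real n)"
        using \<eta> W by (intro mult_left_mono) auto
      also have "\<dots> = \<epsilon>\<^sup>2 * bump_energy / 16"
        by (simp add: \<epsilon>(2) W_def mult_ac)
      finally have "ennreal (\<eta> * W / 32 * real n powr (- 2 * s / (2 * s + 1))) \<le> ennreal (\<epsilon>\<^sup>2 * bump_energy / 16)"
        by (rule ennreal_leI)
      also have "\<dots> \<le> (SUP f\<in>density_class c s (real m) L. risk c n fhat f)"
        by (rule risk_lower_bound[OF K(1) n \<epsilon>(1) b B(2) \<epsilon>B chi est D])
      finally show "ennreal (\<eta> * W / 32 * real n powr (- 2 * s / (2 * s + 1))) \<le>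
          (SUP f\<in>density_class c s (real m) L. risk c n fhat f)" .
    qed
  qed
qed

end
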